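(* Let $n\ge 1$ and let $S$ be a compact subset of $\mathbb{T}^n$. Then: (i) $S$ is an interpolation set for $A(\mathbb{D}^n)$ if and only if it is an interpolation set for $A_{\vec 0}(\mathbb{D}^n)$; (ii) $S$ is a null set for $A_{\vec 0}(\mathbb{D}^n)^\perp$ if and only if it is a null set for $A(\mathbb{D}^n)^\perp$. Consequently, $S$ has the property that for every $f\in C(S)$ there exists $g\in A_{\vec 0}(\mathbb{D}^n)$ with $g|_S=f$ if and only if $S$ is a null set for $A_{\vec 0}(\mathbb{D}^n)^\perp$.
   Context: $M(\mathbb{T}^n)$ denotes the complex Borel measures of bounded variation on $\mathbb{T}^n$. $A(\mathbb{D}^n)$ is the polydisc algebra (functions continuous on $\overline{\mathbb{D}}^n$ and holomorphic on $\mathbb{D}^n$), regarded via restriction as a subspace of $C(\mathbb{T}^n)$ with the supremum norm. $A_{\vec 0}(\mathbb{D}^n)=\{z_1z_2\cdots z_n f(z): f\in A(\mathbb{D}^n)\}$. For a subspace $X\subset C(\mathbb{T}^n)$, $X^\perp$ is the set of $\mu\in M(\mathbb{T}^n)$ with $\int_{\mathbb{T}^n} f\,d\mu=0$ for all $f\in X$. A compact set $S\subset\mathbb{T}^n$ is a null set for $X^\perp$ if $|\mu|(S)=0$ for every $\mu\in X^\perp$. $S$ is an interpolation set for $X$ if for every $f\in C(S)$ there is $g\in X$ with $g|_S=f$. *)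

theory Defs
  imports "HOL-Analysis.Analysis"
begin

definition torus :: "(complex^'n::finite) set" where
  "torus = {z. \<forall>i. cmod (z$i) = 1}"

definition closed_polydisc :: "(complex^'n::finite) set" where
  "closed_polydisc = {z. \<forall>i. cmod (z$i) \<le> 1}"

definition open_polydisc :: "(complex^'n::finite) set" where
  "open_polydisc = {z. \<forall>i. cmod (z$i) < 1}"

definition holomorphic_multi :: "(complex^'n::finite \<Rightarrow> complex) \<Rightarrow> (complex^'n) set \<Rightarrow> bool" where
  "holomorphic_multi f U \<longleftrightarrow>
     (\<forall>z\<in>U. \<exists>L. (f has_derivative L) (at z) \<and> (\<forall>c x. L (c *s x) = c * L x))"

text \<open>The polydisc algebra A(D^n); it is regarded as a subspace of C(T^n) by restriction
  (only values on the torus are ever used below).\<close>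
definition polydisc_algebra :: "(complex^'n::finite \<Rightarrow> complex) set" where
  "polydisc_algebra = {f. continuous_on closed_polydisc f \<and> holomorphic_multi f open_polydisc}"

definition polydisc_algebra0 :: "(complex^'n::finite \<Rightarrow> complex) set" where
  "polydisc_algebra0 = {g. \<exists>f\<in>polydisc_algebra. \<forall>z. g z = (\<Prod>i\<in>UNIV. z$i) * f z}"

text \<open>A complex Borel measure of bounded variation on T^n is represented as
  \<open>\<mu> = h \<cdot> M\<close>: \<open>M\<close> a finite positive Borel measure concentrated on the torus and
  \<open>h \<in> L\<^sup>1(M)\<close>. Then \<open>\<integral> f d\<mu> = \<integral> f h dM\<close> and \<open>|\<mu>|(S) = \<integral>\<^sub>S |h| dM\<close>.
  Every complex measure arises this way (e.g. M = |\<mu>|, h = d\<mu>/d|\<mu>|).\<close>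
definition cmeasure_rep :: "(complex^'n::finite) measure \<Rightarrow> (complex^'n \<Rightarrow> complex) \<Rightarrow> bool" where
  "cmeasure_rep M h \<longleftrightarrow> finite_measure M \<and> sets M = sets borel \<and>
      emeasure M (UNIV - torus) = 0 \<and> integrable M h"

definition cm_integral :: "(complex^'n::finite) measure \<Rightarrow> (complex^'n \<Rightarrow> complex) \<Rightarrow>
    (complex^'n \<Rightarrow> complex) \<Rightarrow> complex" where
  "cm_integral M h f = (\<integral>z. indicator torus z * f z * h z \<partial>M)"

definition total_variation :: "(complex^'n::finite) measure \<Rightarrow> (complex^'n \<Rightarrow> complex) \<Rightarrow>
    (complex^'n) set \<Rightarrow> real" where
  "total_variation M h S = (\<integral>z. indicator S z * cmod (h z) \<partial>M)"

definition annihilator :: "(complex^'n::finite \<Rightarrow> complex) set \<Rightarrow>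
    ((complex^'n) measure \<times> (complex^'n \<Rightarrow> complex)) set" where
  "annihilator X = {(M, h). cmeasure_rep M h \<and> (\<forall>f\<in>X. cm_integral M h f = 0)}"

definition null_set_for :: "((complex^'n::finite) measure \<times> (complex^'n \<Rightarrow> complex)) set \<Rightarrow>
    (complex^'n) set \<Rightarrow> bool" where
  "null_set_for Y S \<longleftrightarrow> (\<forall>(M, h)\<in>Y. total_variation M h S = 0)"

definition interpolation_set :: "(complex^'n::finite \<Rightarrow> complex) set \<Rightarrow> (complex^'n) set \<Rightarrow> bool" where
  "interpolation_set X S \<longleftrightarrow>
     (\<forall>f. continuous_on S f \<longrightarrow> (\<exists>g\<in>X. \<forall>z\<in>S. g z = f z))"

end

theory Submission
  imports Defs "HOL-Complex_Analysis.Conformal_Mappings"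
begin

text \<open>Let \<open>e = z\<^sub>1 \<cdots> z\<^sub>n\<close>. Multiplication by \<open>e\<close>, which is unimodular on the torus, gives (i) and (ii), so
  it remains to compare interpolation and null sets for \<open>A = A(D\<^sup>n)\<close>.

  Interpolation implies null: by Baire's theorem there is a constant \<open>C\<close> such that every continuous
  \<open>f\<close> on \<open>S\<close> is interpolated with norm at most \<open>C \<parallel>f\<parallel>\<close>. Let \<open>E \<subseteq> S\<close> be compact and let \<open>\<phi>\<close> be a trigonometric
  polynomial close to the indicator of \<open>E\<close>. For large \<open>m\<close> the function \<open>e\<^sup>m \<phi>\<close> lies in \<open>A\<close>, and if
  \<open>u \<in> A\<close> interpolates \<open>e\<^sup>-\<^sup>m\<close> on \<open>S\<close> then \<open>u e\<^sup>m \<phi> \<in> A\<close> equals \<open>\<phi>\<close> on \<open>S\<close> and is at most \<open>C |\<phi>|\<close> elsewhere.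
  Dominated convergence shows \<open>\<mu>(E) = 0\<close> for \<open>\<mu>\<close> in the annihilator.

  Null implies interpolation (Bishop): it suffices to approximate every \<open>f\<close> in the unit ball of \<open>C(S)\<close> up
  to \<open>1/2\<close> by some \<open>g \<in> A\<close> with norm at most \<open>2\<close>. Otherwise a Hahn-Banach argument yields a finitely
  additive mean on the constraints, which is represented by a random variable on \<open>[0,1)\<close>; its
  push-forward is an annihilating measure that charges \<open>S\<close>.\<close>

section \<open>The polydisc algebra\<close>

lemma torus_subset_closed_polydisc: "torus \<subseteq> closed_polydisc"
  by (auto simp: torus_def closed_polydisc_def)

lemma open_polydisc_subset_closed_polydisc: "open_polydisc \<subseteq> closed_polydisc"
  by (auto simp: open_polydisc_def closed_polydisc_def less_imp_le)

lemma open_open_polydisc: "open (open_polydisc :: (complex^'n::finite) set)"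
proof -
  have "open {z :: complex^'n. cmod (z$i) < 1}" for i
    by (intro open_Collect_less continuous_intros)
  then have "open (\<Inter>i. {z :: complex^'n. cmod (z$i) < 1})" by auto
  then show ?thesis by (simp add: open_polydisc_def Collect_all_eq)
qed

lemma closed_torus: "closed (torus :: (complex^'n::finite) set)"
  unfolding torus_def by (intro closed_Collect_all closed_Collect_eq continuous_intros)

lemma compact_closed_polydisc: "compact (closed_polydisc :: (complex^'n::finite) set)"
proof -
  have "closed (closed_polydisc :: (complex^'n::finite) set)"
    unfolding closed_polydisc_def by (intro closed_Collect_all closed_Collect_le continuous_intros)
  moreover have "norm z \<le> CARD('n)" if "z \<in> closed_polydisc" for z :: "complex^'n"
  proof -
    have "norm z \<le> (\<Sum>i\<in>UNIV. cmod (z$i))"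
      unfolding norm_vec_def by (rule L2_set_le_sum) simp
    also have "\<dots> \<le> (\<Sum>i\<in>(UNIV::'n set). 1)"
      using that by (intro sum_mono) (auto simp: closed_polydisc_def)
    finally show ?thesis by simp
  qed
  ultimately show ?thesis by (auto simp: compact_eq_bounded_closed bounded_iff)
qed

lemma compact_torus: "compact (torus :: (complex^'n::finite) set)"
  using compact_closed_polydisc closed_torus torus_subset_closed_polydisc
  by (metis compact_Int_closed inf.absorb2)

lemma torus_nonempty: "(torus :: (complex^'n::finite) set) \<noteq> {}"
proof -
  have "(\<chi> i. 1) \<in> (torus :: (complex^'n) set)" by (simp add: torus_def)
  then show ?thesis by blast
qed

lemma norm_prod_torus: "z \<in> torus \<Longrightarrow> cmod (\<Prod>i\<in>UNIV. z$i) = 1"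
  by (simp add: torus_def prod_norm[symmetric])

section \<open>Algebraic closure properties\<close>

lemma polydisc_algebra_continuous: "f \<in> polydisc_algebra \<Longrightarrow> continuous_on closed_polydisc f"
  by (simp add: polydisc_algebra_def)

lemma polydisc_algebra_holomorphicE:
  assumes "f \<in> polydisc_algebra" "z \<in> open_polydisc"
  obtains L where "(f has_derivative L) (at z)" "\<And>c x. L (c *s x) = c * L x"
  using assms by (auto simp: polydisc_algebra_def holomorphic_multi_def)

lemma polydisc_algebra_const: "(\<lambda>z. c) \<in> polydisc_algebra"
  unfolding polydisc_algebra_def holomorphic_multi_def
  by (auto intro!: exI[of _ "\<lambda>_. 0"])

lemma polydisc_algebra_component: "(\<lambda>z. z $ i) \<in> polydisc_algebra"
  unfolding polydisc_algebra_def holomorphic_multi_def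
  by (auto intro!: continuous_intros exI[of _ "\<lambda>z. z $ i"]
      bounded_linear_imp_has_derivative bounded_linear_vec_nth)

lemma polydisc_algebra_add:
  assumes "f \<in> polydisc_algebra" "g \<in> polydisc_algebra"
  shows "(\<lambda>z. f z + g z) \<in> polydisc_algebra"
proof -
  have "\<exists>L. ((\<lambda>z. f z + g z) has_derivative L) (at z) \<and> (\<forall>c x. L (c *s x) = c * L x)"
    if z: "z \<in> open_polydisc" for z
  proof -
    obtain L where L: "(f has_derivative L) (at z)" "\<And>c x. L (c *s x) = c * L x"
      using polydisc_algebra_holomorphicE[OF assms(1) z] by blast
    obtain K where K: "(g has_derivative K) (at z)" "\<And>c x. K (c *s x) = c * K x"
      using polydisc_algebra_holomorphicE[OF assms(2) z] by blast
    show ?thesis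
      using has_derivative_add[OF L(1) K(1)] L(2) K(2) by (auto simp: algebra_simps)
  qed
  then show ?thesis
    using assms by (auto simp: polydisc_algebra_def holomorphic_multi_def intro!: continuous_intros)
qed

lemma polydisc_algebra_mult:
  assumes "f \<in> polydisc_algebra" "g \<in> polydisc_algebra"
  shows "(\<lambda>z. f z * g z) \<in> polydisc_algebra"
proof -
  have "\<exists>L. ((\<lambda>z. f z * g z) has_derivative L) (at z) \<and> (\<forall>c x. L (c *s x) = c * L x)"
    if z: "z \<in> open_polydisc" for z
  proof -
    obtain L where L: "(f has_derivative L) (at z)" "\<And>c x. L (c *s x) = c * L x"
      using polydisc_algebra_holomorphicE[OF assms(1) z] by blast
    obtain K where K: "(g has_derivative K) (at z)" "\<And>c x. K (c *s x) = c * K x"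
      using polydisc_algebra_holomorphicE[OF assms(2) z] by blast
    show ?thesis
      using has_derivative_mult[OF L(1) K(1)] L(2) K(2) by (auto simp: algebra_simps)
  qed
  then show ?thesis
    using assms by (auto simp: polydisc_algebra_def holomorphic_multi_def intro!: continuous_intros)
qed

lemma polydisc_algebra_cmult: "f \<in> polydisc_algebra \<Longrightarrow> (\<lambda>z. c * f z) \<in> polydisc_algebra"
  by (intro polydisc_algebra_mult polydisc_algebra_const)

lemma polydisc_algebra_diff:
  assumes "f \<in> polydisc_algebra" "g \<in> polydisc_algebra"
  shows "(\<lambda>z. f z - g z) \<in> polydisc_algebra"
  using polydisc_algebra_add[OF assms(1) polydisc_algebra_cmult[OF assms(2), of "-1"]] by simp

lemma polydisc_algebra_sum:
  "(\<And>i. i \<in> I \<Longrightarrow> f i \<in> polydisc_algebra) \<Longrightarrow> (\<lambda>z. \<Sum>i\<in>I. f i z) \<in> polydisc_algebra"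
  by (induction I rule: infinite_finite_induct)
    (auto intro: polydisc_algebra_const polydisc_algebra_add)

lemma polydisc_algebra_prod:
  "(\<And>i. i \<in> I \<Longrightarrow> f i \<in> polydisc_algebra) \<Longrightarrow> (\<lambda>z. \<Prod>i\<in>I. f i z) \<in> polydisc_algebra"
  by (induction I rule: infinite_finite_induct)
    (auto intro: polydisc_algebra_const polydisc_algebra_mult)

lemma polydisc_algebra_power:
  assumes "f \<in> polydisc_algebra" shows "(\<lambda>z. f z ^ m) \<in> polydisc_algebra"
  by (induction m) (auto intro: polydisc_algebra_const polydisc_algebra_mult assms)

lemma polydisc_algebra0_subset: "polydisc_algebra0 \<subseteq> polydisc_algebra"
proof
  fix g :: "complex^'n \<Rightarrow> complex" assume "g \<in> polydisc_algebra0"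
  then obtain f where f: "f \<in> polydisc_algebra" and "\<And>z. g z = (\<Prod>i\<in>UNIV. z$i) * f z"
    by (auto simp: polydisc_algebra0_def)
  then have "g = (\<lambda>z. (\<Prod>i\<in>UNIV. z$i) * f z)" by auto
  then show "g \<in> polydisc_algebra"
    by (simp add: polydisc_algebra_mult polydisc_algebra_prod polydisc_algebra_component f)
qed

section \<open>Slices along complex lines, Cauchy estimates and the maximum principle on the
  torus\<close>

lemma vector_smult_has_derivative: "((\<lambda>t. t *s v) has_derivative (\<lambda>t. t *s v)) (at (t::complex))"
proof (rule bounded_linear_imp_has_derivative, rule bounded_linearI')
  show "(x + y) *s v = x *s v + y *s v" for x y by (simp add: vec.scale_left_distrib)
  show "(r *\<^sub>R x) *s v = r *\<^sub>R (x *s v)" for r x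
    by (simp add: vec_eq_iff)
qed

text \<open>Complex homogeneity of \<open>L\<close> turns the real derivative along a complex line
  into multiplication by \<open>L v\<close>. This is the bridge to one-variable function
  theory.\<close>

lemma slice_has_field_derivative:
  fixes a v :: "complex^'n::finite"
  assumes "(f has_derivative L) (at (a + t *s v))" "\<And>c x. L (c *s x) = c * L x"
  shows "((\<lambda>t. f (a + t *s v)) has_field_derivative L v) (at t)"
proof -
  have "((\<lambda>t. a + t *s v) has_derivative (\<lambda>t. t *s v)) (at t)"
    by (rule derivative_eq_intros vector_smult_has_derivative | simp)+
  from has_derivative_compose[OF this assms(1)]
  show ?thesis unfolding has_field_derivative_def assms(2) by (simp add: mult_commute_abs)
qed

lemma norm_vector_smult: "norm (c *s v) = cmod c * norm (v :: complex^'n::finite)"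
  unfolding norm_vec_def by (simp add: norm_mult L2_set_right_distrib)

lemma polydisc_algebra_slice_holomorphic:
  assumes "f \<in> polydisc_algebra" "\<And>t. t \<in> U \<Longrightarrow> a + t *s v \<in> open_polydisc" "open U"
  shows "(\<lambda>t. f (a + t *s v)) holomorphic_on U"
proof -
  have "\<exists>D. ((\<lambda>t. f (a + t *s v)) has_field_derivative D) (at t)" if "t \<in> U" for t
    using polydisc_algebra_holomorphicE[OF assms(1) assms(2)[OF that]] slice_has_field_derivative
    by metis
  then show ?thesis using assms(3) by (auto simp: holomorphic_on_open)
qed

text \<open>Cauchy's inequality at the centre of the slice through \<open>z\<close> in direction
  \<open>v\<close>.\<close>

lemma polydisc_algebra_derivative_bound:
  fixes f :: "complex^'n::finite \<Rightarrow> complex"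
  assumes f: "f \<in> polydisc_algebra" and B: "\<And>z. z \<in> closed_polydisc \<Longrightarrow> cmod (f z) \<le> B"
    and r: "0 < r" "cball z r \<subseteq> open_polydisc"
    and L: "(f has_derivative L) (at z)" "\<And>c x. L (c *s x) = c * L x"
  shows "cmod (L v) \<le> B / r * norm v"
proof (cases "v = 0")
  case True
  then show ?thesis using L(2)[of 0 0] by simp
next
  case False
  \<comment> \<open>With this radius, \<open>t\<close> with \<open>cmod t \<le> \<rho>\<close> moves
    \<open>z + t *s v\<close> by at most \<open>r\<close>, so the slice stays in the given
    ball.\<close>
  define \<rho> where "\<rho> = r / norm v"
  have \<rho>: "\<rho> > 0" using False r by (simp add: \<rho>_def)
  have sub: "z + t *s v \<in> open_polydisc" if "t \<in> cball 0 \<rho>" for t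
  proof -
    have "cmod t * norm v \<le> \<rho> * norm v" using that by (intro mult_right_mono) auto
    then have "z + t *s v \<in> cball z r" using False
      by (simp add: dist_norm norm_vector_smult \<rho>_def)
    then show ?thesis using r by auto
  qed
  have deriv: "((\<lambda>t. f (z + t *s v)) has_field_derivative L v) (at 0)"
    using L by (intro slice_has_field_derivative) auto
  have "continuous_on (cball 0 \<rho>) (\<lambda>t. f (z + t *s v))"
  proof (rule continuous_on_compose2[OF polydisc_algebra_continuous[OF f]])
    show "continuous_on (cball 0 \<rho>) (\<lambda>t. z + t *s v)"
      by (intro continuous_intros continuous_at_imp_continuous_on ballI
          has_derivative_continuous[OF vector_smult_has_derivative])
  qed (use sub open_polydisc_subset_closed_polydisc in blast)
  moreover have "(\<lambda>t. f (z + t *s v)) holomorphic_on ball 0 \<rho>"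
    by (rule polydisc_algebra_slice_holomorphic[OF f]) (use sub in auto)
  moreover have "cmod (f (z + t *s v)) \<le> B" if "norm (0 - t) = \<rho>" for t
    using that by (intro B) (use sub[of t] open_polydisc_subset_closed_polydisc in auto)
  ultimately have "norm ((deriv ^^ 1) (\<lambda>t. f (z + t *s v)) 0) \<le> fact 1 * B / \<rho> ^ 1"
    using \<rho> by (intro Cauchy_inequality) auto
  then show ?thesis using DERIV_imp_deriv[OF deriv] by (simp add: \<rho>_def)
qed

text \<open>Induction on the set \<open>J\<close> of coordinates allowed off the unit circle. In
  coordinate \<open>j\<close> the dilated slice is holomorphic on a disc of radius
  \<open>1/r > 1\<close>, and the maximum principle on the unit disc trades \<open>z$j\<close> for
  points of the circle, so that only \<open>J\<close> remains.\<close>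

lemma polydisc_algebra_dilation_bound:
  fixes f :: "complex^'n::finite \<Rightarrow> complex"
  assumes f: "f \<in> polydisc_algebra" and r: "0 < r" "r < 1"
    and B: "\<And>z. z \<in> torus \<Longrightarrow> cmod (f (of_real r *s z)) \<le> B"
    and z: "z \<in> closed_polydisc"
  shows "cmod (f (of_real r *s z)) \<le> B"
proof -
  have "cmod (f (of_real r *s z)) \<le> B"
    if "finite J" "z \<in> closed_polydisc" "\<And>i. i \<notin> J \<Longrightarrow> cmod (z$i) = 1" for J and z :: "complex^'n"
    using that
  proof (induction J arbitrary: z rule: finite_induct)
    case empty
    then show ?case by (intro B) (auto simp: torus_def)
  next
    case (insert j J)
    define a where "a = (\<chi> i. if i = j then 0 else of_real r * z$i)"
    define v :: "complex^'n" where "v = axis j (of_real r)"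
    have upd: "a + t *s v = of_real r *s (\<chi> i. if i = j then t else z$i)" for t
      by (simp add: vec_eq_iff a_def v_def axis_def mult.commute)
    have op: "a + t *s v \<in> open_polydisc" if "t \<in> ball 0 (1/r)" for t
    proof -
      have "r * cmod t < 1" using that r by (simp add: field_simps)
      moreover have "r * cmod (z$i) < 1" for i
      proof -
        have "r * cmod (z$i) \<le> r * 1" 
          using insert.prems(1) r by (intro mult_left_mono) (auto simp: closed_polydisc_def)
        then show ?thesis using r by linarith
      qed
      ultimately show ?thesis
        using r by (auto simp: upd open_polydisc_def norm_mult)
    qed
    have hol: "(\<lambda>t. f (a + t *s v)) holomorphic_on ball 0 (1/r)"
      by (rule polydisc_algebra_slice_holomorphic[OF f op]) auto
    have sub: "cball 0 1 \<subseteq> ball (0::complex) (1/r)"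
      using r by (simp add: cball_subset_ball_iff)
    have "cmod (f (a + (z$j) *s v)) \<le> B"
    proof (rule maximum_modulus_frontier[of "\<lambda>t. f (a + t *s v)" "cball 0 1" B])
      show "(\<lambda>t. f (a + t *s v)) holomorphic_on interior (cball 0 1)"
        using sub by (intro holomorphic_on_subset[OF hol]) auto
      show "continuous_on (closure (cball 0 1)) (\<lambda>t. f (a + t *s v))"
        using sub by (intro holomorphic_on_imp_continuous_on holomorphic_on_subset[OF hol]) auto
      show "cmod (f (a + t *s v)) \<le> B" if "t \<in> frontier (cball 0 1)" for t
        unfolding upd
      proof (rule insert.IH)
        show "(\<chi> i. if i = j then t else z $ i) \<in> closed_polydisc"
          using that insert.prems(1) by (auto simp: closed_polydisc_def)
        show "cmod ((\<chi> i. if i = j then t else z $ i) $ i) = 1" if "i \<notin> J" for i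
          using that \<open>t \<in> _\<close> insert.prems(2) by auto
      qed
      show "z $ j \<in> cball 0 1" using insert.prems(1) by (auto simp: closed_polydisc_def)
    qed auto
    moreover have "(\<chi> i. if i = j then z$j else z$i) = z" by (simp add: vec_eq_iff)
    ultimately show ?case unfolding upd by simp
  qed
  from this[of UNIV z] z show ?thesis by auto
qed

text \<open>An element of the algebra need not be holomorphic in one variable when the others lie on the
  boundary, so the one-variable maximum principle is applied to dilations, coordinate by
  coordinate.\<close>
lemma polydisc_algebra_maximum_modulus:
  fixes f :: "complex^'n::finite \<Rightarrow> complex"
  assumes f: "f \<in> polydisc_algebra" and B: "\<And>z. z \<in> torus \<Longrightarrow> cmod (f z) \<le> B"
    and z: "z \<in> closed_polydisc"
  shows "cmod (f z) \<le> B"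
proof (rule field_le_epsilon)
  fix e :: real assume e: "0 < e"
  have "uniformly_continuous_on closed_polydisc f"
    using compact_uniformly_continuous[OF polydisc_algebra_continuous[OF f] compact_closed_polydisc] .
  then obtain d where d: "d > 0"
    and ucont: "\<And>x y. x \<in> closed_polydisc \<Longrightarrow> y \<in> closed_polydisc \<Longrightarrow> dist y x < d
      \<Longrightarrow> dist (f y) (f x) < e/2"
    unfolding uniformly_continuous_on_def using e by (metis half_gt_zero)
  obtain b where b: "b > 0" "\<And>x::complex^'n. x \<in> closed_polydisc \<Longrightarrow> norm x \<le> b"
    using compact_imp_bounded[OF compact_closed_polydisc] bounded_pos by metis
  \<comment> \<open>The factor \<open>1 - d / (2*b)\<close> moves points of norm at most
    \<open>b\<close> by at most \<open>d/2\<close>; the maximum with \<open>1/2\<close> keeps it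
    positive.\<close>
  define r where "r = max (1/2) (1 - d / (2*b))"
  have r: "0 < r" "r < 1" "(1 - r) * b < d"
    using b d by (auto simp: r_def max_def field_simps)
  have close: "cmod (f (of_real r *s x) - f x) < e/2" if "x \<in> closed_polydisc" for x
  proof -
    have "of_real r *s x - x = of_real (r - 1) *s x"
      by (simp add: vec_eq_iff algebra_simps)
    then have "dist (of_real r *s x) x = norm (of_real (r - 1) *s x)"
      by (simp add: dist_norm)
    also have "\<dots> = (1 - r) * norm x"
      unfolding norm_vector_smult norm_of_real using r by simp
    also have "\<dots> \<le> (1 - r) * b" using b(2)[OF that] r by (intro mult_left_mono) auto
    finally have "dist (of_real r *s x) x < d" using r by simp
    moreover have "of_real r *s x \<in> closed_polydisc"
      using that r by (auto simp: closed_polydisc_def norm_mult mult_le_one)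
    ultimately show ?thesis using ucont[OF that] by (simp add: dist_norm)
  qed
  have "cmod (f (of_real r *s z)) \<le> B + e/2"
  proof (rule polydisc_algebra_dilation_bound[OF f r(1,2) _ z])
    fix x :: "complex^'n" assume x: "x \<in> torus"
    then have "cmod (f (of_real r *s x) - f x) < e/2"
      using close torus_subset_closed_polydisc by blast
    then show "cmod (f (of_real r *s x)) \<le> B + e/2"
      using B[OF x] norm_triangle_sub[of "f (of_real r *s x)" "f x"] by linarith
  qed
  then show "cmod (f z) \<le> B + e"
    using close[OF z] norm_triangle_sub[of "f z" "f (of_real r *s z)"]
    by (simp add: norm_minus_commute)
qed

section \<open>Convergent series and successive approximation\<close>

text \<open>The Weierstrass test gives continuity. Locally, Cauchy estimates turn the bounds
  \<open>b k\<close> into summable bounds \<open>b k / r\<close> for the derivatives, so the series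
  may be differentiated term by term, and complex homogeneity passes to the sum.\<close>

lemma polydisc_algebra_suminf:
  fixes g :: "nat \<Rightarrow> complex^'n::finite \<Rightarrow> complex"
  assumes g: "\<And>k. g k \<in> polydisc_algebra"
    and b: "\<And>k z. z \<in> closed_polydisc \<Longrightarrow> cmod (g k z) \<le> b k" "summable b"
  shows "(\<lambda>z. \<Sum>k. g k z) \<in> polydisc_algebra"
proof -
  have "uniform_limit closed_polydisc (\<lambda>n z. \<Sum>k<n. g k z) (\<lambda>z. \<Sum>k. g k z) sequentially"
    by (rule Weierstrass_m_test[OF b])
  then have cont: "continuous_on closed_polydisc (\<lambda>z. \<Sum>k. g k z)"
    by (rule uniform_limit_theorem[rotated])
      (simp, intro always_eventually allI continuous_on_sum polydisc_algebra_continuous g)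
  have "\<exists>L. ((\<lambda>z. \<Sum>k. g k z) has_derivative L) (at a) \<and> (\<forall>c x. L (c *s x) = c * L x)"
    if a: "a \<in> open_polydisc" for a
  proof -
    obtain R where R: "R > 0" "cball a R \<subseteq> open_polydisc"
      using open_contains_cball open_open_polydisc a by metis
    \<comment> \<open>Half the radius leaves every point of \<open>ball a r\<close> a closed ball of
      radius \<open>r\<close> inside the polydisc, as the Cauchy estimate requires.\<close>
    define r where "r = R / 2"
    have r: "r > 0" using R by (simp add: r_def)
    have sub: "cball x r \<subseteq> open_polydisc" if "x \<in> ball a r" for x
    proof -
      have "cball x r \<subseteq> cball a R"
      proof
        fix y assume "y \<in> cball x r"
        then show "y \<in> cball a R"
          using that dist_triangle[of a y x] by (simp add: r_def)
      qed
      with R show ?thesis by blast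
    qed
    have ballsub: "x \<in> open_polydisc" if "x \<in> ball a r" for x
      using sub[OF that] r by auto
    have "\<exists>L. x \<in> ball a r \<longrightarrow>
      (g k has_derivative L) (at x) \<and> (\<forall>c v. L (c *s v) = c * L v)" for k x
      using g[of k] ballsub[of x] unfolding polydisc_algebra_def holomorphic_multi_def by blast
    then obtain D where "\<forall>k x. x \<in> ball a r \<longrightarrow>
      (g k has_derivative D k x) (at x) \<and> (\<forall>c v. D k x (c *s v) = c * D k x v)"
      by moura
    then have D: "\<And>k x. x \<in> ball a r \<Longrightarrow> (g k has_derivative D k x) (at x)"
      and Dc: "\<And>k x c v. x \<in> ball a r \<Longrightarrow> D k x (c *s v) = c * D k x v"
      by auto
    have Db: "cmod (D k x v) \<le> b k / r * norm v" if "x \<in> ball a r" for k x v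
      using polydisc_algebra_derivative_bound[OF g b(1) r sub[OF that] D[OF that] Dc[OF that]] .
    have sb: "summable (\<lambda>k. b k / r * norm v)" for v :: "complex^'n"
      by (intro summable_mult2 summable_divide b)
    have sD: "summable (\<lambda>k. D k x v)" if "x \<in> ball a r" for x v
      by (rule summable_comparison_test[OF _ sb[of v]]) (use Db[OF that] in auto)
    have "\<exists>f. \<forall>x\<in>ball a r. (\<lambda>k. g k x) sums f x \<and>
        (f has_derivative (\<lambda>v. \<Sum>k. D k x v)) (at x within ball a r)"
    proof (rule has_derivative_series)
      show "(g k has_derivative D k x) (at x within ball a r)" if "x \<in> ball a r" for k x
        using D[OF that] by (rule has_derivative_at_withinI)
      show "\<forall>\<^sub>F n in sequentially. \<forall>x\<in>ball a r. \<forall>h.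
          cmod ((\<Sum>i<n. D i x h) - (\<Sum>k. D k x h)) \<le> e * norm h" if e: "e > 0" for e
      proof -
        have "(\<lambda>n. \<Sum>k. b (k + n)) \<longlonglongrightarrow> 0"
          using suminf_exist_split2[OF b(2)] by simp
        then have "\<forall>\<^sub>F n in sequentially. (\<Sum>k. b (k + n)) < e * r"
          using e r by (intro order_tendstoD) auto
        then show ?thesis
        proof eventually_elim
          case (elim n)
          show ?case
          proof (intro ballI allI)
            fix x and h :: "complex^'n" assume x: "x \<in> ball a r"
            have "cmod ((\<Sum>i<n. D i x h) - (\<Sum>k. D k x h)) = cmod (\<Sum>k. D (k + n) x h)"
              using suminf_split_initial_segment[OF sD[OF x, of h], of n]
              by (simp add: norm_minus_commute)
            also have "\<dots> \<le> (\<Sum>k. b (k + n) / r * norm h)"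
            proof (rule norm_suminf_le)
              show "summable (\<lambda>k. b (k + n) / r * norm h)"
                using sb[of h] by (rule summable_ignore_initial_segment)
            qed (use Db[OF x] in auto)
            also have "\<dots> = (\<Sum>k. b (k + n)) / r * norm h"
              using sums_mult2[OF sums_divide[OF summable_sums[
                    OF summable_ignore_initial_segment[OF b(2), of n]], of r], of "norm h"]
              by (rule sums_unique[symmetric])
            also have "\<dots> \<le> e * norm h"
              using elim r by (intro mult_right_mono) (auto simp: field_simps)
            finally show "cmod ((\<Sum>i<n. D i x h) - (\<Sum>k. D k x h)) \<le> e * norm h" .
          qed
        qed
      qed
      show "a \<in> ball a r" using r by simp
      have "summable (\<lambda>k. g k a)"
        using b(1)[of a] a open_polydisc_subset_closed_polydisc
        by (intro summable_comparison_test[OF _ b(2)]) blast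
      then show "(\<lambda>k. g k a) sums (\<Sum>k. g k a)" by (rule summable_sums)
    qed simp
    then obtain f where f: "\<And>x. x \<in> ball a r \<Longrightarrow> (\<lambda>k. g k x) sums f x"
      "\<And>x. x \<in> ball a r \<Longrightarrow> (f has_derivative (\<lambda>v. \<Sum>k. D k x v)) (at x within ball a r)"
      by blast
    have "(f has_derivative (\<lambda>v. \<Sum>k. D k a v)) (at a)"
      using f(2)[of a] r by (simp add: at_within_open[of _ "ball a r"])
    then have "((\<lambda>z. \<Sum>k. g k z) has_derivative (\<lambda>v. \<Sum>k. D k a v)) (at a)"
      by (rule has_derivative_transform_within_open[of _ _ _ _ "ball a r"])
        (use r f(1) in \<open>auto simp: sums_iff\<close>)
    moreover have "(\<Sum>k. D k a (c *s x)) = c * (\<Sum>k. D k a x)" for c x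
      using r sD[of a x] by (simp add: Dc suminf_mult)
    ultimately show ?thesis by blast
  qed
  with cont show ?thesis by (simp add: polydisc_algebra_def holomorphic_multi_def)
qed

text \<open>Successive approximation: the error, doubled, lies again in the unit ball, so the
  approximants of all stages, weighted by powers of \<open>1/2\<close>, sum to an exact interpolant.
  Their bounds form a geometric series with sum \<open>2 * B\<close>.\<close>

lemma interpolation_of_approximation:
  fixes S :: "(complex^'n::finite) set"
  assumes S: "S \<subseteq> torus"
    and approx: "\<And>f. continuous_on S f \<Longrightarrow> (\<And>z. z \<in> S \<Longrightarrow> cmod (f z) \<le> 1) \<Longrightarrow>
      \<exists>g\<in>polydisc_algebra. (\<forall>z\<in>torus. cmod (g z) \<le> B) \<and> (\<forall>z\<in>S. cmod (f z - g z) \<le> 1/2)"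
    and f: "continuous_on S f" "\<And>z. z \<in> S \<Longrightarrow> cmod (f z) \<le> 1"
  shows "\<exists>g\<in>polydisc_algebra. (\<forall>z\<in>torus. cmod (g z) \<le> 2 * B) \<and> (\<forall>z\<in>S. g z = f z)"
proof -
  have scont: "continuous_on S g" if "g \<in> polydisc_algebra" for g
    by (rule continuous_on_subset[OF polydisc_algebra_continuous[OF that]])
      (rule order_trans[OF S torus_subset_closed_polydisc])
  define good where "good \<phi> g \<longleftrightarrow> g \<in> polydisc_algebra \<and> (\<forall>z\<in>torus. cmod (g z) \<le> B)
    \<and> (\<forall>z\<in>S. cmod (\<phi> z - g z) \<le> 1/2)" for \<phi> g :: "complex^'n \<Rightarrow> complex"
  define pick where "pick \<phi> = (SOME g. good \<phi> g)" for \<phi>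
  have pick: "good \<phi> (pick \<phi>)"
    if "continuous_on S \<phi>" "\<And>z. z \<in> S \<Longrightarrow> cmod (\<phi> z) \<le> 1" for \<phi>
  proof -
    have "\<exists>g. good \<phi> g" using approx[OF that] unfolding good_def by blast
    then show ?thesis unfolding pick_def by (rule someI_ex)
  qed
  \<comment> \<open>\<open>\<phi> k\<close> is the error left after \<open>k\<close> stages,
    magnified by \<open>2^k\<close>.\<close>
  define \<phi> where "\<phi> = rec_nat f (\<lambda>_ \<phi> z. 2 * (\<phi> z - pick \<phi> z))"
  have \<phi>0: "\<phi> 0 = f" and \<phi>Suc: "\<And>k. \<phi> (Suc k) = (\<lambda>z. 2 * (\<phi> k z - pick (\<phi> k) z))"
    by (simp_all add: \<phi>_def)
  have \<phi>: "continuous_on S (\<phi> k) \<and> (\<forall>z\<in>S. cmod (\<phi> k z) \<le> 1)" for k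
  proof (induction k)
    case 0
    then show ?case using f by (simp add: \<phi>0)
  next
    case (Suc k)
    then have "good (\<phi> k) (pick (\<phi> k))" by (intro pick) auto
    then have pA: "pick (\<phi> k) \<in> polydisc_algebra"
      and half: "\<And>z. z \<in> S \<Longrightarrow> cmod (\<phi> k z - pick (\<phi> k) z) \<le> 1/2"
      by (auto simp: good_def)
    have "continuous_on S (\<phi> (Suc k))"
      using Suc scont[OF pA] unfolding \<phi>Suc by (intro continuous_intros) auto
    moreover have "cmod (\<phi> (Suc k) z) \<le> 1" if "z \<in> S" for z
      using half[OF that] unfolding \<phi>Suc norm_mult by simp
    ultimately show ?case by blast
  qed
  then have good: "good (\<phi> k) (pick (\<phi> k))" for k by (intro pick) auto
  define g where "g k = (\<lambda>z. (1/2)^k * pick (\<phi> k) z)" for k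
  have gA: "g k \<in> polydisc_algebra" for k
    using good[of k] unfolding g_def good_def by (intro polydisc_algebra_cmult) auto
  have gT: "cmod (g k z) \<le> B * (1/2)^k" if "z \<in> torus" for k z
    using good[of k] that unfolding g_def good_def
    by (auto simp: norm_mult norm_power norm_divide mult.commute[of B] intro!: mult_left_mono)
  \<comment> \<open>The assumption bounds the approximants on the torus; the maximum principle
    carries the bound to the closed polydisc, where the series must converge uniformly.\<close>
  have gD: "cmod (g k z) \<le> B * (1/2)^k" if "z \<in> closed_polydisc" for k z
    using polydisc_algebra_maximum_modulus[OF gA gT that] .
  have sB: "(\<lambda>k. B * (1/2)^k) sums (2 * B)"
    using sums_mult[OF geometric_sums[of "1/2::real"], of B] by (simp add: mult.commute)
  have sumg: "(\<Sum>k<n. g k z) = f z - (1/2)^n * \<phi> n z" for n z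
  proof (induction n)
    case 0
    then show ?case by (simp add: \<phi>0)
  next
    case (Suc n)
    define c where "c = (1/2::complex)^n"
    have "(\<Sum>k<Suc n. g k z) = f z - c * \<phi> n z + c * pick (\<phi> n) z"
      using Suc by (simp add: g_def c_def)
    also have "\<dots> = f z - (1/2 * c) * (2 * (\<phi> n z - pick (\<phi> n) z))"
      by (simp add: algebra_simps)
    finally show ?case by (simp add: c_def \<phi>Suc)
  qed
  have "(\<Sum>k. g k z) = f z" if z: "z \<in> S" for z
  proof -
    have "(\<lambda>n. (1/2)^n * \<phi> n z) \<longlonglongrightarrow> 0"
    proof (rule Lim_null_comparison)
      show "\<forall>\<^sub>F n in sequentially. cmod ((1/2)^n * \<phi> n z) \<le> (1/2)^n"
        using \<phi> z by (intro always_eventually) (auto simp: norm_mult norm_power norm_divide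
            intro!: mult_left_le)
    qed (simp add: LIMSEQ_power_zero)
    then have "(\<lambda>n. f z - (1/2)^n * \<phi> n z) \<longlonglongrightarrow> f z - 0"
      by (intro tendsto_intros)
    then have "(\<lambda>k. g k z) sums f z" unfolding sums_def sumg by simp
    then show ?thesis by (simp add: sums_iff)
  qed
  moreover have "(\<lambda>z. \<Sum>k. g k z) \<in> polydisc_algebra"
    using gD sums_summable[OF sB] by (intro polydisc_algebra_suminf[OF gA]) auto
  moreover have "cmod (\<Sum>k. g k z) \<le> 2 * B" if "z \<in> torus" for z
    using norm_suminf_le[OF gT[OF that] sums_summable[OF sB]] sums_unique[OF sB] by simp
  ultimately show ?thesis by (intro bexI[of _ "\<lambda>z. \<Sum>k. g k z"]) auto
qed

section \<open>Means and their representation\<close>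

text \<open>A mean is integration against a finitely additive probability on \<open>X\<close>.
  \<open>\<Phi>\<close> is total, but its values on functions unbounded on \<open>X\<close> are left
  free.\<close>

locale mean =
  fixes X :: "'a set" and \<Phi> :: "('a \<Rightarrow> real) \<Rightarrow> real"
  assumes add: "bounded (f ` X) \<Longrightarrow> bounded (g ` X) \<Longrightarrow> \<Phi> (\<lambda>x. f x + g x) = \<Phi> f + \<Phi> g"
    and scale: "bounded (f ` X) \<Longrightarrow> \<Phi> (\<lambda>x. c * f x) = c * \<Phi> f"
    and pos: "bounded (f ` X) \<Longrightarrow> (\<And>x. x \<in> X \<Longrightarrow> 0 \<le> f x) \<Longrightarrow> 0 \<le> \<Phi> f"
    and one: "\<Phi> (\<lambda>x. 1) = 1"

lemma bounded_image_add:
  fixes f g :: "'a \<Rightarrow> real"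
  shows "bounded (f ` X) \<Longrightarrow> bounded (g ` X) \<Longrightarrow> bounded ((\<lambda>x. f x + g x) ` X)"
  by (rule bounded_plus_comp)

lemma bounded_image_scale:
  fixes f :: "'a \<Rightarrow> real"
  shows "bounded (f ` X) \<Longrightarrow> bounded ((\<lambda>x. c * f x) ` X)"
  using bounded_scaleR_comp[of f X c] by simp

text \<open>Zorn's lemma gives a maximal space \<open>W\<close> of functions with nonnegative supremum. Maximality makes
  \<open>W\<close> a complement of the constants, and the mean is the projection along \<open>W\<close>.\<close>
lemma exists_mean:
  fixes V :: "('a \<Rightarrow> real) set"
  assumes bdd: "\<And>v. v \<in> V \<Longrightarrow> bounded (v ` X)"
    and nonempty: "V \<noteq> {}"
    and add: "\<And>v w. v \<in> V \<Longrightarrow> w \<in> V \<Longrightarrow> (\<lambda>x. v x + w x) \<in> V"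
    and scale: "\<And>c v. v \<in> V \<Longrightarrow> (\<lambda>x. c * v x) \<in> V"
    and nonneg: "\<And>v e. v \<in> V \<Longrightarrow> 0 < e \<Longrightarrow> \<exists>x\<in>X. - e < v x"
  shows "\<exists>\<Phi>. mean X \<Phi> \<and> (\<forall>v\<in>V. \<Phi> v = 0)"
proof -
  \<comment> \<open>The last clause forbids uniformly negative elements; since \<open>W\<close> is
    closed under negation, it contains no nonzero constant.\<close>
  define sub where "sub W \<longleftrightarrow> (\<forall>v\<in>W. bounded (v ` X)) \<and> (\<forall>v\<in>W. \<forall>w\<in>W. (\<lambda>x. v x + w x) \<in> W) \<and>
    (\<forall>c. \<forall>v\<in>W. (\<lambda>x. c * v x) \<in> W) \<and> (\<forall>v\<in>W. \<forall>e>0. \<exists>x\<in>X. - e < v x)"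
    for W :: "('a \<Rightarrow> real) set"
  have "\<exists>W\<in>{W. V \<subseteq> W \<and> sub W}. \<forall>W'\<in>{W. V \<subseteq> W \<and> sub W}. W \<subseteq> W' \<longrightarrow> W' = W"
  proof (rule subset_Zorn_nonempty)
    have "sub V"
      unfolding sub_def by (intro conjI ballI allI impI bdd add scale nonneg)
    then show "{W. V \<subseteq> W \<and> sub W} \<noteq> {}" by blast
    fix \<C> assume ne: "\<C> \<noteq> {}" and chain: "subset.chain {W. V \<subseteq> W \<and> sub W} \<C>"
    then have C: "\<And>W. W \<in> \<C> \<Longrightarrow> V \<subseteq> W \<and> sub W"
      by (auto simp: subset.chain_def)
    have "(\<lambda>x. v x + w x) \<in> \<Union>\<C>" if vw: "v \<in> A" "A \<in> \<C>" "w \<in> B" "B \<in> \<C>" for v w A B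
    proof -
      have "A \<subseteq> B \<or> B \<subseteq> A" using chain vw by (auto simp: subset_chain_def)
      then obtain D where "D \<in> \<C>" "v \<in> D" "w \<in> D" using vw by blast
      then have "(\<lambda>x. v x + w x) \<in> D" using C[of D] by (auto simp: sub_def)
      with \<open>D \<in> \<C>\<close> show ?thesis by blast
    qed
    moreover have "bounded (v ` X) \<and> (\<lambda>x. c * v x) \<in> \<Union>\<C> \<and> (\<forall>e>0. \<exists>x\<in>X. - e < v x)"
      if "v \<in> A" "A \<in> \<C>" for v c A
      using C[OF that(2)] that unfolding sub_def by blast
    ultimately have "sub (\<Union>\<C>)" unfolding sub_def by (intro conjI ballI allI impI) blast+
    moreover have "V \<subseteq> \<Union>\<C>" using ne C by blast
    ultimately show "\<Union>\<C> \<in> {W. V \<subseteq> W \<and> sub W}" by simp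
  qed
  then obtain W where VW: "V \<subseteq> W" and "sub W"
    and max: "\<And>W'. W \<subseteq> W' \<Longrightarrow> sub W' \<Longrightarrow> W' = W"
    by auto
  then have Wb: "\<And>v. v \<in> W \<Longrightarrow> bounded (v ` X)"
    and Wadd: "\<And>v w. v \<in> W \<Longrightarrow> w \<in> W \<Longrightarrow> (\<lambda>x. v x + w x) \<in> W"
    and Wscale: "\<And>c v. v \<in> W \<Longrightarrow> (\<lambda>x. c * v x) \<in> W"
    and Wnonneg: "\<And>v e. v \<in> W \<Longrightarrow> 0 < e \<Longrightarrow> \<exists>x\<in>X. - e < v x"
    by (auto simp: sub_def)
  have W0: "(\<lambda>x. 0) \<in> W"
    using nonempty VW Wscale[of _ 0] by auto
  have Wneg: "\<not> (\<forall>x\<in>X. v x \<le> - e)" if "v \<in> W" "0 < e" for v e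
    using Wnonneg[OF that] by force
  have decomp: "\<exists>c. (\<lambda>x. f x - c) \<in> W" if f: "bounded (f ` X)" for f
  proof (rule ccontr)
    assume contr: "\<nexists>c. (\<lambda>x. f x - c) \<in> W"
    \<comment> \<open>If no \<open>f - c\<close> lies in \<open>W\<close>, maximality makes every
      adjunction of \<open>f - c\<close> create a uniformly negative element; \<open>U\<close> and
      \<open>L\<close> record whether \<open>f - c\<close> enters it with positive or negative
      coefficient. Both are nonempty, they are disjoint and cover the line, and neither can contain
      \<open>Inf U\<close>: a connectedness argument.\<close>
    define U where "U = {c. \<exists>w\<in>W. \<exists>e>0. \<forall>x\<in>X. w x + (f x - c) \<le> - e}"
    define L where "L = {c. \<exists>w\<in>W. \<exists>e>0. \<forall>x\<in>X. w x - (f x - c) \<le> - e}"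
    have UI: "c \<in> U"
      if "w \<in> W" "0 < e" "\<And>x. x \<in> X \<Longrightarrow> w x + (f x - c) \<le> - e" for w c e
      unfolding U_def mem_Collect_eq using that by (intro bexI[of _ w] exI[of _ e]) auto
    have LI: "c \<in> L"
      if "w \<in> W" "0 < e" "\<And>x. x \<in> X \<Longrightarrow> w x - (f x - c) \<le> - e" for w c e
      unfolding L_def mem_Collect_eq using that by (intro bexI[of _ w] exI[of _ e]) auto
    have UL: "c \<in> U \<or> c \<in> L" for c
    proof -
      \<comment> \<open>\<open>W'\<close> is the span of \<open>W\<close> and \<open>f - c\<close>.
        It is a linear space of bounded functions, so only the last clause of \<open>sub\<close> can
        fail. Dividing the offending element by the modulus of \<open>t\<close> places
        \<open>c\<close> in \<open>U\<close> or \<open>L\<close>; \<open>t = 0\<close> would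
        contradict the clause for \<open>W\<close>.\<close>
      define W' where "W' = {v. \<exists>w\<in>W. \<exists>t. v = (\<lambda>x. w x + t * (f x - c))}"
      have W'I: "(\<lambda>x. w x + t * (f x - c)) \<in> W'" if "w \<in> W" for w t
        unfolding W'_def using that by blast
      have "W \<subseteq> W'" using W'I[of _ 0] by auto
      moreover have "(\<lambda>x. f x - c) \<in> W'" using W'I[OF W0, of 1] by simp
      ultimately have "\<not> sub W'" using max contr by blast
      moreover have "bounded (v ` X)" if v': "v \<in> W'" for v
      proof -
        obtain w t where "w \<in> W" and v: "v = (\<lambda>x. w x + t * (f x + (- c)))"
          using v' by (auto simp: W'_def)
        show ?thesis unfolding v
          by (rule bounded_image_add[OF Wb[OF \<open>w \<in> W\<close>] bounded_image_scale[OF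
                bounded_image_add[OF f]]]) (auto intro: boundedI[of _ "\<bar>c\<bar>"])
      qed
      moreover have "(\<lambda>x. v x + w x) \<in> W'" if v': "v \<in> W'" "w \<in> W'" for v w
      proof -
        obtain v' t w' s where "v' \<in> W" "v = (\<lambda>x. v' x + t * (f x - c))"
          "w' \<in> W" "w = (\<lambda>x. w' x + s * (f x - c))"
          using v' by (auto simp: W'_def)
        then have "(\<lambda>x. v' x + w' x) \<in> W"
          "(\<lambda>x. v x + w x) = (\<lambda>x. (v' x + w' x) + (t + s) * (f x - c))"
          by (auto intro: Wadd simp: algebra_simps)
        then show ?thesis using W'I[of "\<lambda>x. v' x + w' x" "t + s"] by simp
      qed
      moreover have "(\<lambda>x. k * v x) \<in> W'" if v': "v \<in> W'" for k v
      proof -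
        obtain v' t where "v' \<in> W" "v = (\<lambda>x. v' x + t * (f x - c))"
          using v' by (auto simp: W'_def)
        then have "(\<lambda>x. k * v' x) \<in> W" "(\<lambda>x. k * v x) = (\<lambda>x. k * v' x + (k * t) * (f x - c))"
          by (auto intro: Wscale simp: algebra_simps)
        then show ?thesis using W'I[of "\<lambda>x. k * v' x" "k * t"] by simp
      qed
      ultimately obtain v e where "v \<in> W'" "e > 0" and neg: "\<And>x. x \<in> X \<Longrightarrow> v x \<le> - e"
        unfolding sub_def not_less[symmetric] by blast
      then obtain w t where w: "w \<in> W" and v: "v = (\<lambda>x. w x + t * (f x - c))"
        by (auto simp: W'_def)
      consider "t = 0" | "t > 0" | "t < 0" by linarith
      then show ?thesis
      proof cases
        case 1
        then have False using neg Wneg[OF w \<open>e > 0\<close>] by (simp add: v)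
        then show ?thesis ..
      next
        case 2
        have "(1/t) * w x + (f x - c) \<le> - (e/t)" if "x \<in> X" for x
        proof -
          have "(w x + t * (f x - c)) / t \<le> (- e) / t"
            using neg[OF that] 2 by (intro divide_right_mono) (auto simp: v)
          then show ?thesis using 2 by (simp add: add_divide_distrib)
        qed
        moreover have "(\<lambda>x. (1/t) * w x) \<in> W" "e / t > 0"
          using Wscale[OF w, of "1/t"] \<open>e > 0\<close> 2 by simp_all
        ultimately show ?thesis using UI[of "\<lambda>x. (1/t) * w x"] by blast
      next
        case 3
        have "(1/(-t)) * w x - (f x - c) \<le> - (e/(-t))" if "x \<in> X" for x
        proof -
          have "(w x + t * (f x - c)) / (- t) \<le> (- e) / (- t)"
            using neg[OF that] 3 by (intro divide_right_mono) (auto simp: v)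
          then show ?thesis using 3 by (simp add: add_divide_distrib)
        qed
        moreover have "(\<lambda>x. (1/(-t)) * w x) \<in> W" "e / (-t) > 0"
          using Wscale[OF w, of "1/(-t)"] divide_pos_pos[of e "- t"] \<open>e > 0\<close> 3 by simp_all
        ultimately show ?thesis using LI[of "\<lambda>x. (1/(-t)) * w x"] by blast
      qed
    qed
    have disj: False if c: "c \<in> U" "c \<in> L" for c
    proof -
      obtain u d where u: "u \<in> W" "d > 0" "\<And>x. x \<in> X \<Longrightarrow> u x + (f x - c) \<le> - d"
        using c by (auto simp: U_def)
      obtain l e where l: "l \<in> W" "e > 0" "\<And>x. x \<in> X \<Longrightarrow> l x - (f x - c) \<le> - e"
        using c by (auto simp: L_def)
      have "u x + l x \<le> - (d + e)" if "x \<in> X" for x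
        using u(3)[OF that] l(3)[OF that] by linarith
      then show False using Wneg[OF Wadd[OF u(1) l(1)], of "d + e"] u(2) l(2) by auto
    qed
    have Umono: "c' \<in> U" if c: "c \<in> U" "c \<le> c'" for c c'
    proof -
      obtain u d where u: "u \<in> W" "d > 0" "\<And>x. x \<in> X \<Longrightarrow> u x + (f x - c) \<le> - d"
        using c by (auto simp: U_def)
      have "u x + (f x - c') \<le> - d" if "x \<in> X" for x
        using u(3)[OF that] \<open>c \<le> c'\<close> by linarith
      then show ?thesis by (rule UI[OF u(1,2)])
    qed
    have Uopen: "\<exists>c'\<in>U. c' < c" if c: "c \<in> U" for c
    proof -
      obtain u d where u: "u \<in> W" "d > 0" "\<And>x. x \<in> X \<Longrightarrow> u x + (f x - c) \<le> - d"
        using c by (auto simp: U_def)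
      have "u x + (f x - (c - d/2)) \<le> - (d/2)" if "x \<in> X" for x
        using u(3)[OF that] by (simp add: field_simps)
      then have "c - d/2 \<in> U" by (rule UI[OF u(1) half_gt_zero[OF u(2)]])
      then show ?thesis using u(2) by (intro bexI[of _ "c - d/2"]) auto
    qed
    have Lopen: "\<exists>c'\<in>L. c < c'" if c: "c \<in> L" for c
    proof -
      obtain u d where u: "u \<in> W" "d > 0" "\<And>x. x \<in> X \<Longrightarrow> u x - (f x - c) \<le> - d"
        using c by (auto simp: L_def)
      have "u x - (f x - (c + d/2)) \<le> - (d/2)" if "x \<in> X" for x
        using u(3)[OF that] by (simp add: field_simps)
      then have "c + d/2 \<in> L" by (rule LI[OF u(1) half_gt_zero[OF u(2)]])
      then show ?thesis using u(2) by (intro bexI[of _ "c + d/2"]) auto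
    qed
    obtain K where K: "\<And>x. x \<in> X \<Longrightarrow> \<bar>f x\<bar> \<le> K"
      using f by (auto simp: bounded_iff)
    have "K + 1 \<in> U"
    proof (rule UI[OF W0])
      fix x assume "x \<in> X" then show "0 + (f x - (K + 1)) \<le> - 1" using K[of x] by linarith
    qed simp
    have KL: "- K - 1 \<in> L"
    proof (rule LI[OF W0])
      fix x assume "x \<in> X" then show "0 - (f x - (- K - 1)) \<le> - 1" using K[of x] by linarith
    qed simp
    have "bdd_below U"
      using disj[OF Umono KL] by (intro bdd_belowI[of _ "- K - 1"]) force
    from UL[of "Inf U"] show False
    proof
      assume "Inf U \<in> U"
      then show False using Uopen cInf_lower[OF _ \<open>bdd_below U\<close>] by fastforce
    next
      assume "Inf U \<in> L"
      then obtain c where "c \<in> L" "Inf U < c" using Lopen by blast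
      moreover then obtain u where "u \<in> U" "u < c"
        using cInf_lessD[of U c] \<open>K + 1 \<in> U\<close> by blast
      ultimately show False using Umono disj by (meson less_imp_le)
    qed
  qed
  have uniq: "c = d" if "(\<lambda>x. f x - c) \<in> W" "(\<lambda>x. f x - d) \<in> W" for f c d
  proof -
    \<comment> \<open>Otherwise \<open>W\<close> would contain the negative constant
      \<open>b - a\<close>.\<close>
    have "\<not> b < a" if "(\<lambda>x. f x - a) \<in> W" "(\<lambda>x. f x - b) \<in> W" for a b
    proof
      assume "b < a"
      have "(\<lambda>x. (f x - a) + (-1) * (f x - b)) \<in> W" using that by (intro Wadd Wscale)
      then show False using Wneg[of _ "a - b"] \<open>b < a\<close> by fastforce
    qed
    then show ?thesis using that by (meson linorder_neqE_linordered_idom)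
  qed
  define \<Phi> where "\<Phi> f = (THE c. (\<lambda>x. f x - c) \<in> W)" for f
  have \<Phi>: "\<Phi> f = c" if "(\<lambda>x. f x - c) \<in> W" for f c
    unfolding \<Phi>_def using that uniq by blast
  have \<Phi>W: "(\<lambda>x. f x - \<Phi> f) \<in> W" if "bounded (f ` X)" for f
    using decomp[OF that] \<Phi> by blast
  have "mean X \<Phi>"
  proof
    fix f g :: "'a \<Rightarrow> real" and c :: real
    assume f: "bounded (f ` X)"
    show "\<Phi> (\<lambda>x. c * f x) = c * \<Phi> f"
      using Wscale[OF \<Phi>W[OF f], of c] by (intro \<Phi>) (simp add: algebra_simps)
    show "0 \<le> \<Phi> f" if "\<And>x. x \<in> X \<Longrightarrow> 0 \<le> f x"
    proof (rule ccontr)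
      assume "\<not> 0 \<le> \<Phi> f"
      then show False
        using Wneg[OF Wscale[OF \<Phi>W[OF f], of "-1"], of "- \<Phi> f"] that by fastforce
    qed
    assume g: "bounded (g ` X)"
    show "\<Phi> (\<lambda>x. f x + g x) = \<Phi> f + \<Phi> g"
      using Wadd[OF \<Phi>W[OF f] \<Phi>W[OF g]] by (intro \<Phi>) (simp add: algebra_simps)
  next
    show "\<Phi> (\<lambda>x. 1) = 1" using W0 by (intro \<Phi>) simp
  qed
  moreover have "\<forall>v\<in>V. \<Phi> v = 0" using VW by (auto intro!: \<Phi>)
  ultimately show ?thesis by blast
qed

section \<open>Elementary calculus of means\<close>

context mean
begin

lemma bounded_indicator: "bounded ((\<lambda>x. indicator A x :: real) ` X)"
  by (rule boundedI[of _ 1]) (auto simp: indicator_def)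

lemma mono:
  assumes f: "bounded (f ` X)" and g: "bounded (g ` X)" and le: "\<And>x. x \<in> X \<Longrightarrow> f x \<le> g x"
  shows "\<Phi> f \<le> \<Phi> g"
proof -
  have "0 \<le> \<Phi> (\<lambda>x. g x + (-1) * f x)"
    by (rule pos[OF bounded_image_add[OF g bounded_image_scale[OF f]]]) (use le in auto)
  also have "\<dots> = \<Phi> g + (-1) * \<Phi> f"
    by (simp only: add[OF g bounded_image_scale[OF f]] scale[OF f])
  finally show ?thesis by simp
qed

lemma cong:
  assumes "bounded (f ` X)" and eq: "\<And>x. x \<in> X \<Longrightarrow> f x = g x"
  shows "\<Phi> f = \<Phi> g"
proof -
  have "f ` X = g ` X" using eq by (rule image_cong[OF refl])
  then have "bounded (g ` X)" using assms(1) by simp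
  then show ?thesis using assms by (intro antisym mono) auto
qed

lemma const: "\<Phi> (\<lambda>x. c) = c"
proof -
  have "bounded ((\<lambda>x. 1::real) ` X)" by (rule boundedI[of _ 1]) auto
  from scale[OF this, of c] show ?thesis by (simp add: one)
qed

lemma sum:
  assumes "finite I" "\<And>i. i \<in> I \<Longrightarrow> bounded (h i ` X)"
  shows "bounded ((\<lambda>x. \<Sum>i\<in>I. a i * h i x) ` X)
    \<and> \<Phi> (\<lambda>x. \<Sum>i\<in>I. a i * h i x) = (\<Sum>i\<in>I. a i * \<Phi> (h i))"
  using assms
proof (induction I rule: finite_induct)
  case empty
  then show ?case using const[of 0] by (auto intro: boundedI[of _ 0])
next
  case (insert i I)
  then have i: "bounded (h i ` X)" and I: "bounded ((\<lambda>x. \<Sum>i\<in>I. a i * h i x) ` X)"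
    and eq: "\<Phi> (\<lambda>x. \<Sum>i\<in>I. a i * h i x) = (\<Sum>i\<in>I. a i * \<Phi> (h i))"
    by auto
  show ?case
    using bounded_image_add[OF bounded_image_scale[OF i, of "a i"] I]
      add[OF bounded_image_scale[OF i, of "a i"] I] insert.hyps by (simp add: eq scale[OF i])
qed

lemma nonempty: "X \<noteq> {}"
  using cong[of "\<lambda>x. 0" "\<lambda>x. 1"] const[of 0] one by auto

end

section \<open>Representation of a mean by a random variable\<close>

text \<open>Total boundedness covers \<open>X\<close> by finitely many balls of radius
  \<open>e/2\<close>; labelling a point by the first ball containing it turns the cover into a
  partition.\<close>

lemma compact_finite_cells:
  fixes X :: "'a::metric_space set"
  assumes "compact X" "0 < e"
  shows "\<exists>q::'a \<Rightarrow> nat. \<exists>N. (\<forall>x\<in>X. q x < N) \<and> (\<forall>x\<in>X. \<forall>y\<in>X. q x = q y \<longrightarrow> dist x y < e)"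
proof -
  obtain C where "finite C" and C: "X \<subseteq> (\<Union>c\<in>C. ball c (e/2))"
    using assms compact_eq_totally_bounded half_gt_zero by metis
  then obtain xs where xs: "set xs = C" using finite_list by blast
  define q where "q x = (LEAST i. i < length xs \<and> x \<in> ball (xs ! i) (e/2))" for x
  have q: "q x < length xs \<and> x \<in> ball (xs ! q x) (e/2)" if x: "x \<in> X" for x
  proof -
    have "\<exists>i. i < length xs \<and> x \<in> ball (xs ! i) (e/2)"
    proof -
      obtain c where "c \<in> set xs" "x \<in> ball c (e/2)" using x C xs by blast
      then show ?thesis by (metis in_set_conv_nth)
    qed
    then show ?thesis unfolding q_def by (rule LeastI_ex)
  qed
  moreover have "dist x y < e" if "x \<in> X" "y \<in> X" "q x = q y" for x y
    using q[OF that(1)] q[OF that(2)] that(3) dist_triangle_half_r[of "xs ! q x" x e y] by simp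
  ultimately show ?thesis by blast
qed

text \<open>Strict monotonicity cannot be asked for: cells of mass zero make consecutive values of
  \<open>G\<close> coincide, and their half-open intervals are empty.\<close>

lemma nat_bracket_unique:
  fixes G :: "nat \<Rightarrow> real"
  assumes mono: "mono G" and i: "G i \<le> t" "t < G (Suc i)" and j: "G j \<le> t" "t < G (Suc j)"
  shows "i = j"
proof -
  have "\<not> a < b" if "t < G (Suc a)" "G b \<le> t" for a b
    using that monoD[OF mono, of "Suc a" b] by auto
  then show ?thesis using i j by (metis linorder_neqE_nat)
qed

text \<open>The mean assigns a mass to every cell of a refining sequence of finite partitions of \<open>X\<close>. Cells
  are numbered lexicographically and represented by consecutive intervals of that length, so that
  nested cells correspond to nested intervals; a point of \<open>[0,1)\<close> then picks a shrinking sequence of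
  cells. This replaces the Riesz representation theorem.\<close>
theorem skorokhod_representation:
  fixes X :: "'a::metric_space set"
  assumes X: "compact X" and "mean X \<Phi>"
  shows "\<exists>Y\<in>borel_measurable borel. (\<forall>t::real. Y t \<in> X) \<and>
    (\<forall>f. continuous_on X f \<longrightarrow> (\<integral>t. indicator {0..<1} t * f (Y t) \<partial>lborel) = \<Phi> f)"
proof -
  interpret mean X \<Phi> by fact
  obtain x0 where x0: "x0 \<in> X" using nonempty by blast
  have "\<exists>q::'a \<Rightarrow> nat. \<exists>N. (\<forall>x\<in>X. q x < N) \<and> (\<forall>x\<in>X. \<forall>y\<in>X. q x = q y \<longrightarrow> dist x y < (1/2)^k)" for k
    by (intro compact_finite_cells X) simp
  then obtain q :: "nat \<Rightarrow> 'a \<Rightarrow> nat" and N where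
    qN: "\<And>k x. x \<in> X \<Longrightarrow> q k x < N k"
    and q: "\<And>k x y. x \<in> X \<Longrightarrow> y \<in> X \<Longrightarrow> q k x = q k y \<Longrightarrow> dist x y < (1/2)^k"
    by metis
  \<comment> \<open>\<open>c k x\<close> is the mixed-radix number with digits
    \<open>q 0 x, ..., q (k-1) x\<close>, the last one least significant. Dividing a number of level
    \<open>Suc k\<close> by \<open>N k\<close> gives the parent cell of level
    \<open>k\<close>.\<close>
  define c where "c = rec_nat (\<lambda>x. 0) (\<lambda>k c x. c x * N k + q k x)"
  have c0: "c 0 x = 0" and cSuc: "c (Suc k) x = c k x * N k + q k x" for k x
    by (simp_all add: c_def)
  define R where "R k = (\<Prod>i<k. N i)" for k
  have N0: "N k > 0" for k using qN[OF x0, of k] by simp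
  have cdiv: "c (Suc k) x div N k = c k x" and cmod: "c (Suc k) x mod N k = q k x"
    if "x \<in> X" for k x
    using qN[OF that, of k] by (simp_all add: cSuc)
  have cR: "c k x < R k" if "x \<in> X" for k x
  proof (induction k)
    case 0
    then show ?case by (simp add: c0 R_def)
  next
    case (Suc k)
    have "c (Suc k) x < (c k x + 1) * N k" using qN[OF that, of k] by (simp add: cSuc)
    also have "\<dots> \<le> R k * N k" using Suc by (intro mult_le_mono1) simp
    finally show ?case by (simp add: R_def)
  qed
  have c_less: "c (Suc k) x < j * N k \<longleftrightarrow> c k x < j" if "x \<in> X" for k x j
    by (metis N0 cdiv[OF that] div_less_iff_less_mult)
  \<comment> \<open>The index shifts by one because \<open>q k x\<close> is the last digit at level
    \<open>Suc k\<close>; level \<open>0\<close> is a single cell of uncontrolled size.\<close>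
  have c_close: "dist x y < (1/2)^k" if "x \<in> X" "y \<in> X" "c (Suc k) x = c (Suc k) y" for k x y
    using q[OF that(1,2)] cmod[OF that(1), of k] cmod[OF that(2), of k] that(3) by simp

  \<comment> \<open>\<open>G k\<close> is the distribution function of the cell number: cell
    \<open>j\<close> gets the interval from \<open>G k j\<close> to \<open>G k (Suc j)\<close>,
    whose length is its mass.\<close>
  define G where "G k j = \<Phi> (indicator {x. c k x < j})" for k j
  have Gmono: "mono (G k)" for k
    unfolding G_def by (intro monoI mono bounded_indicator) (auto simp: indicator_def)
  have G0: "G k 0 = 0" for k
  proof -
    have "G k 0 = \<Phi> (\<lambda>x. 0)" unfolding G_def by (rule cong[OF bounded_indicator]) simp
    then show ?thesis by (simp only: const)
  qed
  have GR: "G k (R k) = 1" for k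
  proof -
    have "G k (R k) = \<Phi> (\<lambda>x. 1)"
      unfolding G_def by (rule cong[OF bounded_indicator]) (simp add: cR)
    then show ?thesis by (simp only: one)
  qed
  \<comment> \<open>The cells numbered below \<open>j\<close> have exactly the children numbered
    below \<open>j * N k\<close>. Hence endpoints of level \<open>k\<close> recur at level
    \<open>Suc k\<close>, and the intervals are nested.\<close>
  have GN: "G (Suc k) (j * N k) = G k j" for k j
    unfolding G_def by (intro cong bounded_indicator) (simp add: c_less indicator_def)
  have Gdiff: "\<Phi> (indicator {x. c k x = j}) = G k (Suc j) - G k j" for k j
  proof -
    have "G k (Suc j) = \<Phi> (\<lambda>x. indicator {x. c k x < j} x + indicator {x. c k x = j} x)"
      unfolding G_def by (intro cong bounded_indicator) (auto simp: indicator_def)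
    also have "\<dots> = G k j + \<Phi> (indicator {x. c k x = j})"
      unfolding G_def by (intro add bounded_indicator)
    finally show ?thesis by simp
  qed

  define J where "J k t = (LEAST j. t < G k (Suc j))" for k t
  have J: "G k (J k t) \<le> t \<and> t < G k (Suc (J k t))" if "t \<in> {0..<1}" for k t
  proof
    have "R k > 0" using cR[OF x0, of k] by simp
    then have "t < G k (Suc (R k - 1))" using that GR by simp
    then show "t < G k (Suc (J k t))" unfolding J_def by (rule LeastI)
    show "G k (J k t) \<le> t"
    proof (cases "J k t")
      case 0
      then show ?thesis using that G0 by simp
    next
      case (Suc j)
      then have "\<not> t < G k (Suc j)" unfolding J_def by (intro not_less_Least) simp
      then show ?thesis using Suc by simp
    qed
  qed
  have Juniq: "J k t = j" if "t \<in> {0..<1}" "G k j \<le> t" "t < G k (Suc j)" for k t j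
    using nat_bracket_unique[OF Gmono] J[OF that(1)] that by blast
  have JR: "J k t < R k" if t: "t \<in> {0..<1}" for k t
  proof (rule ccontr)
    assume "\<not> J k t < R k"
    then have "1 \<le> G k (J k t)" using monoD[OF Gmono, of "R k" "J k t" k] GR by simp
    then show False using J[OF t, of k] t by simp
  qed
  have Jdiv: "J (Suc k) t div N k = J k t" if t: "t \<in> {0..<1}" for k t
  proof -
    define i where "i = J (Suc k) t"
    have "G k (i div N k) = G (Suc k) (i div N k * N k)" by (simp add: GN)
    also have "\<dots> \<le> G (Suc k) i" by (intro monoD[OF Gmono]) simp
    also have "\<dots> \<le> t" using J[OF t] by (simp add: i_def)
    finally have lower: "G k (i div N k) \<le> t" .
    have "t < G (Suc k) (Suc i)" using J[OF t] by (simp add: i_def)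
    also have "\<dots> \<le> G (Suc k) (Suc (i div N k) * N k)"
    proof (intro monoD[OF Gmono])
      show "Suc i \<le> Suc (i div N k) * N k"
        using dividend_less_div_times[OF N0, of i k] by simp
    qed
    finally have "t < G k (Suc (i div N k))" by (simp only: GN)
    with lower show ?thesis using Juniq[OF t] by (simp add: i_def)
  qed
  have cJ: "c k x = J k t" if "k \<le> l" "x \<in> X" "c l x = J l t" "t \<in> {0..<1}" for k l x t
    using that
  proof (induction l rule: dec_induct)
    case base
    then show ?case by simp
  next
    case (step l)
    then show ?case using cdiv[of x l] Jdiv[of t l] by simp
  qed

  define p where "p k j = (SOME x. x \<in> X \<and> c k x = j)" for k j
  have p: "p k j \<in> X \<and> c k (p k j) = j" if "x \<in> X" "c k x = j" for k j x
    unfolding p_def by (rule someI[of _ x]) (use that in simp)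
  \<comment> \<open>An empty cell has mass zero, hence an empty interval, which cannot contain
    \<open>t\<close>.\<close>
  have pJ: "p k (J k t) \<in> X \<and> c k (p k (J k t)) = J k t" if t: "t \<in> {0..<1}" for k t
  proof (rule ccontr)
    assume contr: "\<not> ?thesis"
    have "\<Phi> (indicator {x. c k x = J k t}) = \<Phi> (\<lambda>x. 0)"
      using p[of _ k "J k t"] contr by (intro cong bounded_indicator) (auto simp: indicator_def)
    then show False using J[OF t, of k] by (simp add: Gdiff const)
  qed
  define Z where "Z k t = p k (J k t)" for k t
  have Zclose: "dist (Z m t) (Z n t) < (1/2)^k"
    if "t \<in> {0..<1}" "Suc k \<le> m" "Suc k \<le> n" for m n k t
    using pJ[OF that(1)] cJ[OF that(2) _ _ that(1)] cJ[OF that(3) _ _ that(1)]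
    unfolding Z_def by (intro c_close) auto
  have "\<exists>y\<in>X. (\<lambda>k. Z k t) \<longlonglongrightarrow> y" if t: "t \<in> {0..<1}" for t
  proof -
    have "Cauchy (\<lambda>k. Z k t)"
    proof (rule metric_CauchyI)
      fix e :: real assume "0 < e"
      then obtain k where "(1/2)^k < e" using real_arch_pow_inv[of e "1/2"] by auto
      then show "\<exists>M. \<forall>m\<ge>M. \<forall>n\<ge>M. dist (Z m t) (Z n t) < e"
        using Zclose[OF t, of k] by (intro exI[of _ "Suc k"]) (meson less_trans)
    qed
    then obtain y where "y \<in> X" "(\<lambda>k. Z k t) \<longlonglongrightarrow> y"
      using completeE[OF compact_imp_complete[OF X], of "\<lambda>k. Z k t"] pJ[OF t] by (auto simp: Z_def)
    then show ?thesis by blast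
  qed
  then obtain L where L: "\<And>t. t \<in> {0..<1} \<Longrightarrow> L t \<in> X \<and> (\<lambda>k. Z k t) \<longlonglongrightarrow> L t"
    by metis
  \<comment> \<open>The default \<open>x0\<close> keeps \<open>Y\<close> inside \<open>X\<close>
    outside the unit interval as well.\<close>
  define Y where "Y t = (if t \<in> {0..<1} then L t else x0)" for t :: real
  have J_measurable [measurable]: "J k \<in> measurable borel (count_space UNIV)" for k
    unfolding J_def by measurable
  have "Y \<in> borel_measurable borel"
  proof (rule borel_measurable_LIMSEQ_metric)
    show "(\<lambda>t. if t \<in> {0..<1} then Z k t else x0) \<in> borel_measurable borel" for k
      unfolding Z_def by (intro measurable_If measurable_compose[OF J_measurable]) auto
    show "(\<lambda>k. if t \<in> {0..<1} then Z k t else x0) \<longlonglongrightarrow> Y t" for t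
      using L[of t] by (auto simp: Y_def)
  qed
  moreover have "Y t \<in> X" for t using L[of t] x0 by (auto simp: Y_def)
  moreover have "(\<integral>t. indicator {0..<1} t * f (Y t) \<partial>lborel) = \<Phi> f"
    if f: "continuous_on X f" for f
  \<comment> \<open>Both sides are limits of the integrals of \<open>f (Z k t)\<close>: one by
    dominated convergence, the other because these integrals are means of cellwise constant
    functions converging to \<open>f\<close> uniformly on \<open>X\<close>.\<close>
  proof (rule LIMSEQ_unique)
    have fb: "bounded (f ` X)"
      using compact_imp_bounded[OF compact_continuous_image[OF f X]] .
    then obtain K where K: "\<And>x. x \<in> X \<Longrightarrow> \<bar>f x\<bar> \<le> K" by (auto simp: bounded_iff)
    have K0: "0 \<le> K" using K[OF x0] by simp
    have int1: "integrable lborel (\<lambda>t::real. indicator {0..<1} t * K)"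
      by (intro integrable_mult_left) (simp add: integrable_indicator_iff)
    have fZ_measurable: "(\<lambda>t. indicator {0..<1} t * f (Z k t)) \<in> borel_measurable lborel" for k
      unfolding Z_def using measurable_compose[OF J_measurable, of "\<lambda>j. f (p k j)" borel k]
      by simp
    have lim: "(\<lambda>k. indicator {0..<1} t * f (Z k t)) \<longlonglongrightarrow> indicator {0..<1} t * f (Y t)" for t
    proof (cases "t \<in> {0..<1}")
      case True
      have "(\<lambda>k. f (Z k t)) \<longlonglongrightarrow> f (L t)"
        by (rule continuous_on_tendsto_compose[OF f])
          (use L[OF True] pJ[OF True] in \<open>auto simp: Z_def\<close>)
      then show ?thesis using True by (simp add: Y_def)
    qed simp
    show "(\<lambda>k. \<integral>t. indicator {0..<1} t * f (Z k t) \<partial>lborel) \<longlonglongrightarrow>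
        (\<integral>t. indicator {0..<1} t * f (Y t) \<partial>lborel)"
    proof (rule integral_dominated_convergence[OF _ fZ_measurable int1])
      show "(\<lambda>t. indicator {0..<1} t * f (Y t)) \<in> borel_measurable lborel"
        by (rule borel_measurable_LIMSEQ_real[OF _ fZ_measurable]) (rule lim)
      show "AE t in lborel. norm (indicator {0..<1} t * f (Z k t)) \<le> indicator {0..<1} t * K" for k
      proof (rule AE_I2)
        fix t :: real
        show "norm (indicator {0..<1} t * f (Z k t)) \<le> indicator {0..<1} t * K"
        proof (cases "t \<in> {0..<1}")
          case True
          then show ?thesis using K[of "Z k t"] pJ[OF True, of k] by (simp add: Z_def)
        qed simp
      qed
    qed (use lim in auto)
    \<comment> \<open>\<open>f (Z k t)\<close> is a step function of \<open>t\<close>. Interval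
      lengths equal cell masses, so its integral is the mean of \<open>f\<close> replaced on each
      cell by its value at the representative.\<close>
    have step: "(\<integral>t. indicator {0..<1} t * f (Z k t) \<partial>lborel) = \<Phi> (\<lambda>x. f (p k (c k x)))"
      and stepb: "bounded ((\<lambda>x. f (p k (c k x))) ` X)" for k
    proof -
      have "indicator {0..<1} t * f (Z k t)
          = (\<Sum>j<R k. f (p k j) * indicator {G k j..<G k (Suc j)} t)" for t
      proof (cases "t \<in> {0..<1}")
        case True
        have "indicator {G k j..<G k (Suc j)} t = (if j = J k t then 1 else 0 :: real)" for j
        proof -
          have "t \<in> {G k j..<G k (Suc j)} \<longleftrightarrow> j = J k t"
            using J[OF True, of k] Juniq[OF True, of k j] by (metis atLeastLessThan_iff)
          then show ?thesis by (simp only: indicator_def of_bool_def)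
        qed
        then have "(\<Sum>j<R k. f (p k j) * indicator {G k j..<G k (Suc j)} t)
            = (\<Sum>j<R k. if j = J k t then f (p k j) else 0)"
          by (intro Groups_Big.sum.cong refl) simp
        also have "\<dots> = f (Z k t)" using JR[OF True, of k] by (simp add: Z_def)
        finally show ?thesis using True by simp
      next
        case False
        have "indicator {G k j..<G k (Suc j)} t = (0::real)" if "j < R k" for j
          using False monoD[OF Gmono, of 0 j k] monoD[OF Gmono, of "Suc j" "R k" k] that
          by (auto simp: indicator_def G0 GR)
        then show ?thesis using False by simp
      qed
      moreover have "integrable lborel (indicator {G k j..<G k (Suc j)} :: real \<Rightarrow> real)" for j
        by (simp add: integrable_indicator_iff monoD[OF Gmono])
      ultimately have "(\<integral>t. indicator {0..<1} t * f (Z k t) \<partial>lborel)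
          = (\<Sum>j<R k. \<integral>t. f (p k j) * indicator {G k j..<G k (Suc j)} t \<partial>lborel)"
        by (simp only:) (intro Bochner_Integration.integral_sum integrable_mult_right)
      also have "\<dots> = (\<Sum>j<R k. f (p k j) * (G k (Suc j) - G k j))"
        by (intro Groups_Big.sum.cong refl) (simp add: monoD[OF Gmono])
      also have "\<dots> = \<Phi> (\<lambda>x. \<Sum>j<R k. f (p k j) * indicator {x. c k x = j} x)"
        using sum[of "{..<R k}" "\<lambda>j. indicator {x. c k x = j}"] bounded_indicator
        by (simp add: Gdiff)
      finally have int: "(\<integral>t. indicator {0..<1} t * f (Z k t) \<partial>lborel)
        = \<Phi> (\<lambda>x. \<Sum>j<R k. f (p k j) * indicator {x. c k x = j} x)" .
      have eq: "(\<Sum>j<R k. f (p k j) * indicator {x. c k x = j} x) = f (p k (c k x))"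
        if "x \<in> X" for x
      proof -
        have "(\<Sum>j<R k. f (p k j) * indicator {x. c k x = j} x)
            = (\<Sum>j<R k. if j = c k x then f (p k j) else 0)"
          by (intro Groups_Big.sum.cong refl) simp
        then show ?thesis using cR[OF that, of k] by simp
      qed
      have b: "bounded ((\<lambda>x. \<Sum>j<R k. f (p k j) * indicator {x. c k x = j} x) ` X)"
        using sum[of "{..<R k}" "\<lambda>j. indicator {x. c k x = j}"] bounded_indicator by simp
      show "(\<integral>t. indicator {0..<1} t * f (Z k t) \<partial>lborel) = \<Phi> (\<lambda>x. f (p k (c k x)))"
        unfolding int by (rule cong[OF b eq])
      show "bounded ((\<lambda>x. f (p k (c k x))) ` X)"
        using b by (simp only: image_cong[OF refl eq])
    qed
    show "(\<lambda>k. \<integral>t. indicator {0..<1} t * f (Z k t) \<partial>lborel) \<longlonglongrightarrow> \<Phi> f"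
    proof (rule LIMSEQ_I)
      fix e :: real assume e: "0 < e"
      obtain d where d: "d > 0"
        and ucont: "\<And>x y. x \<in> X \<Longrightarrow> y \<in> X \<Longrightarrow> dist y x < d \<Longrightarrow> dist (f y) (f x) < e/2"
        using compact_uniformly_continuous[OF f X] half_gt_zero[OF e]
        unfolding uniformly_continuous_on_def by metis
      obtain k0 where k0: "(1/2)^k0 < d" using real_arch_pow_inv[OF d, of "1/2"] by auto
      have "norm (\<Phi> (\<lambda>x. f (p k (c k x))) - \<Phi> f) < e" if k1: "Suc k0 \<le> k" for k
      proof -
        \<comment> \<open>Points with equal number at level \<open>Suc l\<close> are closer than
          \<open>(1/2)^l\<close>, so passing to representatives changes \<open>f\<close> by at most
          \<open>e/2\<close>.\<close>
        obtain l where k: "k = Suc l" "k0 \<le> l" using Suc_le_D[OF k1] k1 by auto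
        have close: "\<bar>f (p k (c k x)) - f x\<bar> \<le> e/2" if x: "x \<in> X" for x
        proof -
          have "dist (p k (c k x)) x < (1/2)^l"
            using p[OF x refl, of k] x unfolding k(1) by (intro c_close) auto
          also have "\<dots> \<le> (1/2)^k0" using k(2) by (intro power_decreasing) auto
          finally show ?thesis
            using ucont[OF x, of "p k (c k x)"] p[OF x refl, of k] k0 by (simp add: dist_real_def)
        qed
        have cb: "bounded ((\<lambda>x. e/2) ` X)" by (rule boundedI[of _ "e/2"]) (use e in auto)
        have "\<Phi> (\<lambda>x. f (p k (c k x))) \<le> \<Phi> (\<lambda>x. f x + e/2)"
        proof (rule mono[OF stepb bounded_image_add[OF fb cb]])
          show "f (p k (c k x)) \<le> f x + e/2" if "x \<in> X" for x using close[OF that] by linarith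
        qed
        moreover have "\<Phi> f \<le> \<Phi> (\<lambda>x. f (p k (c k x)) + e/2)"
        proof (rule mono[OF fb bounded_image_add[OF stepb cb]])
          show "f x \<le> f (p k (c k x)) + e/2" if "x \<in> X" for x using close[OF that] by linarith
        qed
        ultimately show ?thesis
          using e by (simp add: add[OF fb cb] add[OF stepb cb] const abs_if)
      qed
      then show "\<exists>k0. \<forall>k\<ge>k0. norm ((\<integral>t. indicator {0..<1} t * f (Z k t) \<partial>lborel) - \<Phi> f) < e"
        unfolding step by blast
    qed
  qed
  ultimately show ?thesis by blast
qed

section \<open>Densities of push-forwards\<close>

lemma integrable_bounded_mult:
  fixes \<phi> h :: "'a \<Rightarrow> complex"
  assumes h: "integrable M h" and \<phi>: "\<phi> \<in> borel_measurable M" and K: "\<And>y. cmod (\<phi> y) \<le> K"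
  shows "integrable M (\<lambda>y. \<phi> y * h y)"
proof (rule Bochner_Integration.integrable_bound[of M "\<lambda>y. K * cmod (h y)"])
  show "integrable M (\<lambda>y. K * cmod (h y))" using h by simp
  show "(\<lambda>y. \<phi> y * h y) \<in> borel_measurable M" using h \<phi> by measurable
  have "norm (\<phi> y * h y) \<le> norm (K * cmod (h y))" for y
    using mult_right_mono[OF K[of y] norm_ge_zero[of "h y"]] abs_ge_self[of "K * cmod (h y)"]
    unfolding real_norm_def norm_mult by linarith
  then show "AE y in M. norm (\<phi> y * h y) \<le> norm (K * cmod (h y))" by (rule AE_I2)
qed

text \<open>The push-forward of \<open>r\<close> times \<open>\<Omega>\<close> is absolutely
  continuous with respect to that of \<open>\<Omega>\<close>. \<open>D\<close> is its Radon-Nikodym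
  density, that is, the conditional expectation of \<open>r\<close> given the value of
  \<open>x\<close>.\<close>

lemma exists_pushforward_density_nonneg:
  fixes r :: "'a \<Rightarrow> real"
  assumes "finite_measure \<Omega>" and x [measurable]: "x \<in> measurable \<Omega> N"
    and r [measurable]: "r \<in> borel_measurable \<Omega>" and bounds: "\<And>w. 0 \<le> r w" "\<And>w. r w \<le> c"
  shows "\<exists>D. integrable (distr \<Omega> N x) D \<and> (\<forall>\<phi>\<in>borel_measurable N.
    (\<integral>y. \<phi> y * complex_of_real (D y) \<partial>distr \<Omega> N x) = (\<integral>w. \<phi> (x w) * complex_of_real (r w) \<partial>\<Omega>))"
proof -
  interpret finite_measure \<Omega> by fact
  define M where "M = distr \<Omega> N x"
  define P where "P = density \<Omega> (\<lambda>w. ennreal (r w))"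
  define Q where "Q = distr P N x"
  interpret M: finite_measure M unfolding M_def by (rule finite_measure_distr[OF x])
  have xP: "x \<in> measurable P N" using x by (simp add: P_def)
  have "integrable \<Omega> r"
    by (rule integrable_const_bound[of _ c]) (use bounds in auto)
  then have "(\<integral>\<^sup>+w. ennreal (r w) \<partial>\<Omega>) = ennreal (\<integral>w. r w \<partial>\<Omega>)"
    using bounds by (intro nn_integral_eq_integral) auto
  moreover have "emeasure P (space P) = (\<integral>\<^sup>+w. ennreal (r w) \<partial>\<Omega>)"
    unfolding P_def by (subst emeasure_density) (auto intro!: nn_integral_cong)
  ultimately interpret P: finite_measure P by (intro finite_measureI) simp
  interpret Q: finite_measure Q unfolding Q_def by (rule P.finite_measure_distr[OF xP])
  have sets: "sets Q = sets M" by (simp add: Q_def M_def)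
  have "absolutely_continuous M Q"
    unfolding absolutely_continuous_def
  proof
    fix A assume "A \<in> null_sets M"
    then have A: "A \<in> sets N" and "emeasure \<Omega> (x -` A \<inter> space \<Omega>) = 0"
      by (auto simp: M_def null_sets_def emeasure_distr)
    then have "x -` A \<inter> space \<Omega> \<in> null_sets \<Omega>" using x by (auto simp: measurable_sets)
    then have "x -` A \<inter> space \<Omega> \<in> null_sets P"
      using absolutely_continuousI_density[of "\<lambda>w. ennreal (r w)" \<Omega>]
      by (auto simp: absolutely_continuous_def P_def)
    then show "A \<in> null_sets Q"
      using A xP by (auto simp: Q_def null_sets_def emeasure_distr P_def)
  qed
  then obtain D where D: "D \<in> borel_measurable M" "\<And>y. 0 \<le> D y"
    and RN: "AE y in M. RN_deriv M Q y = ennreal (D y)" and dens: "density M (RN_deriv M Q) = Q"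
    using M.real_RN_deriv[OF Q.finite_measure_axioms _ sets] M.density_RN_deriv[OF _ sets] by metis
  have "density M (RN_deriv M Q) = density M (\<lambda>y. ennreal (D y))"
    using RN D by (intro density_cong) auto
  with dens have Q: "Q = density M (\<lambda>y. ennreal (D y))" by simp
  have "integrable Q (\<lambda>_. 1::real)" by simp
  then have "integrable M D"
    unfolding Q by (subst (asm) integrable_density) (use D in auto)
  moreover have "(\<integral>y. \<phi> y * complex_of_real (D y) \<partial>M) = (\<integral>w. \<phi> (x w) * complex_of_real (r w) \<partial>\<Omega>)"
    if \<phi>: "\<phi> \<in> borel_measurable N" for \<phi>
  proof -
    have "(\<integral>y. \<phi> y * complex_of_real (D y) \<partial>M) = (\<integral>y. \<phi> y \<partial>Q)"
      unfolding Q using D \<phi>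
      by (subst integral_density) (auto simp: M_def scaleR_conv_of_real mult.commute)
    also have "\<dots> = (\<integral>w. \<phi> (x w) \<partial>P)" unfolding Q_def by (rule integral_distr[OF xP \<phi>])
    also have "\<dots> = (\<integral>w. \<phi> (x w) * complex_of_real (r w) \<partial>\<Omega>)"
      unfolding P_def using bounds measurable_compose[OF x \<phi>]
      by (subst integral_density) (auto simp: scaleR_conv_of_real mult.commute)
    finally show ?thesis .
  qed
  ultimately show ?thesis unfolding M_def by blast
qed

text \<open>Adding the bound \<open>c\<close> makes the real and imaginary parts nonnegative, and
  the constant \<open>C\<close> removes the shift afterwards. Boundedness of \<open>\<phi>\<close>
  makes all terms integrable, so the integrals may be split.\<close>

lemma exists_pushforward_density:
  fixes l :: "'a \<Rightarrow> complex"
  assumes fin: "finite_measure \<Omega>" and x: "x \<in> measurable \<Omega> N"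
    and l: "l \<in> borel_measurable \<Omega>" and c: "\<And>w. cmod (l w) \<le> c"
  shows "\<exists>h. integrable (distr \<Omega> N x) h \<and>
    (\<forall>\<phi>\<in>borel_measurable N. \<forall>K. (\<forall>y. cmod (\<phi> y) \<le> K) \<longrightarrow>
      (\<integral>y. \<phi> y * h y \<partial>distr \<Omega> N x) = (\<integral>w. \<phi> (x w) * l w \<partial>\<Omega>))"
proof -
  interpret finite_measure \<Omega> by fact
  define M where "M = distr \<Omega> N x"
  interpret M: finite_measure M unfolding M_def by (rule finite_measure_distr[OF x])
  have Re: "\<bar>Re (l w)\<bar> \<le> c" and Im: "\<bar>Im (l w)\<bar> \<le> c" for w
    using c[of w] abs_Re_le_cmod[of "l w"] abs_Im_le_cmod[of "l w"] by linarith+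
  have "\<exists>D. integrable (distr \<Omega> N x) D \<and> (\<forall>\<phi>\<in>borel_measurable N.
    (\<integral>y. \<phi> y * complex_of_real (D y) \<partial>distr \<Omega> N x) = (\<integral>w. \<phi> (x w) * complex_of_real (Re (l w) + c) \<partial>\<Omega>))"
  proof (rule exists_pushforward_density_nonneg[OF fin x])
    show "0 \<le> Re (l w) + c" "Re (l w) + c \<le> 2 * c" for w using Re[of w] by linarith+
  qed (use l in measurable)
  then obtain D where D: "integrable M D"
    and intD: "\<And>\<phi>. \<phi> \<in> borel_measurable N \<Longrightarrow> (\<integral>y. \<phi> y * complex_of_real (D y) \<partial>M)
      = (\<integral>w. \<phi> (x w) * complex_of_real (Re (l w) + c) \<partial>\<Omega>)"
    unfolding M_def by blast
  have "\<exists>E. integrable (distr \<Omega> N x) E \<and> (\<forall>\<phi>\<in>borel_measurable N.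
    (\<integral>y. \<phi> y * complex_of_real (E y) \<partial>distr \<Omega> N x) = (\<integral>w. \<phi> (x w) * complex_of_real (Im (l w) + c) \<partial>\<Omega>))"
  proof (rule exists_pushforward_density_nonneg[OF fin x])
    show "0 \<le> Im (l w) + c" "Im (l w) + c \<le> 2 * c" for w using Im[of w] by linarith+
  qed (use l in measurable)
  then obtain E where E: "integrable M E"
    and intE: "\<And>\<phi>. \<phi> \<in> borel_measurable N \<Longrightarrow> (\<integral>y. \<phi> y * complex_of_real (E y) \<partial>M)
      = (\<integral>w. \<phi> (x w) * complex_of_real (Im (l w) + c) \<partial>\<Omega>)"
    unfolding M_def by blast
  define C where "C = complex_of_real c + \<i> * complex_of_real c"
  define h where "h y = complex_of_real (D y) + \<i> * complex_of_real (E y) - C" for y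
  have "integrable M h" unfolding h_def using D E by (intro Bochner_Integration.integrable_diff Bochner_Integration.integrable_add) auto
  moreover have "(\<integral>y. \<phi> y * h y \<partial>M) = (\<integral>w. \<phi> (x w) * l w \<partial>\<Omega>)"
    if \<phi>: "\<phi> \<in> borel_measurable N" and K: "\<And>y. cmod (\<phi> y) \<le> K" for \<phi> K
  proof -
    have \<phi>M: "\<phi> \<in> borel_measurable M" using \<phi> by (simp add: M_def)
    have \<phi>x: "(\<lambda>w. \<phi> (x w)) \<in> borel_measurable \<Omega>" using measurable_compose[OF x \<phi>] .
    have iM: "integrable M (\<lambda>y. \<phi> y * k y)" if "integrable M k" for k
      by (rule integrable_bounded_mult[OF that \<phi>M K])
    have i\<Omega>: "integrable \<Omega> (\<lambda>w. \<phi> (x w) * k w)" if "integrable \<Omega> k" for k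
      by (rule integrable_bounded_mult[OF that \<phi>x K])
    have iRe: "integrable \<Omega> (\<lambda>w. complex_of_real (Re (l w) + c))"
      and iIm: "integrable \<Omega> (\<lambda>w. complex_of_real (Im (l w) + c))"
    proof -
      have "integrable \<Omega> l" by (rule integrable_const_bound[of _ c]) (use c l in auto)
      then show "integrable \<Omega> (\<lambda>w. complex_of_real (Re (l w) + c))"
        "integrable \<Omega> (\<lambda>w. complex_of_real (Im (l w) + c))"
        by (auto intro!: integrable_of_real)
    qed
    have intC: "(\<integral>y. \<phi> y * C \<partial>M) = (\<integral>w. \<phi> (x w) * C \<partial>\<Omega>)"
      unfolding M_def by (intro integral_distr[OF x] borel_measurable_times \<phi> measurable_const) simp
    have "(\<integral>y. \<phi> y * h y \<partial>M) = (\<integral>y. \<phi> y * complex_of_real (D y)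
        + \<i> * (\<phi> y * complex_of_real (E y)) - \<phi> y * C \<partial>M)"
      by (intro Bochner_Integration.integral_cong refl) (simp add: h_def algebra_simps)
    also have "\<dots> = (\<integral>y. \<phi> y * complex_of_real (D y) \<partial>M)
        + \<i> * (\<integral>y. \<phi> y * complex_of_real (E y) \<partial>M) - (\<integral>y. \<phi> y * C \<partial>M)"
      using iM[OF integrable_of_real[OF D]] iM[OF integrable_of_real[OF E]]
        iM[of "\<lambda>_. C"] by simp
    also have "\<dots> = (\<integral>w. \<phi> (x w) * complex_of_real (Re (l w) + c) \<partial>\<Omega>)
        + \<i> * (\<integral>w. \<phi> (x w) * complex_of_real (Im (l w) + c) \<partial>\<Omega>) - (\<integral>w. \<phi> (x w) * C \<partial>\<Omega>)"
      by (simp only: intD[OF \<phi>] intE[OF \<phi>] intC)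
    also have "\<dots> = (\<integral>w. \<phi> (x w) * complex_of_real (Re (l w) + c)
        + \<i> * (\<phi> (x w) * complex_of_real (Im (l w) + c)) - \<phi> (x w) * C \<partial>\<Omega>)"
      using i\<Omega>[OF iRe] i\<Omega>[OF iIm] i\<Omega>[of "\<lambda>_. C"]
      by (simp del: of_real_add)
    also have "\<dots> = (\<integral>w. \<phi> (x w) * l w \<partial>\<Omega>)"
    proof (intro Bochner_Integration.integral_cong refl)
      fix w
      have "l w = complex_of_real (Re (l w)) + \<i> * complex_of_real (Im (l w))"
        by (rule complex_eq)
      then have "\<phi> (x w) * l w = \<phi> (x w) * (complex_of_real (Re (l w)) + \<i> * complex_of_real (Im (l w)))"
        by simp
      then show "\<phi> (x w) * complex_of_real (Re (l w) + c)
        + \<i> * (\<phi> (x w) * complex_of_real (Im (l w) + c)) - \<phi> (x w) * C = \<phi> (x w) * l w"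
        by (simp add: C_def algebra_simps)
    qed
    finally show ?thesis .
  qed
  ultimately show ?thesis
    unfolding M_def[symmetric] by (intro exI[of _ h] conjI ballI allI impI) blast+
qed

section \<open>Null sets are interpolation sets\<close>

lemma borel_measurable_indicator_mult:
  fixes g :: "'a::topological_space \<Rightarrow> complex"
  assumes "closed A" "continuous_on A g"
  shows "(\<lambda>z. indicator A z * g z) \<in> borel_measurable borel"
proof -
  have "(\<lambda>z. indicator A z *\<^sub>R g z) \<in> borel_measurable borel"
    using assms by (intro borel_measurable_continuous_on_indicator) auto
  moreover have "(\<lambda>z. indicator A z *\<^sub>R g z) = (\<lambda>z. indicator A z * g z)"
    by (auto simp: indicator_def)
  ultimately show ?thesis by simp
qed

lemma continuous_on_compact_bound:
  fixes g :: "'a::topological_space \<Rightarrow> complex"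
  assumes "compact A" "continuous_on A g"
  obtains K where "\<And>z. cmod (indicator A z * g z) \<le> K"
proof -
  obtain K where K: "\<And>z. z \<in> A \<Longrightarrow> cmod (g z) \<le> K"
    using compact_imp_bounded[OF compact_continuous_image[OF assms(2,1)]] by (auto simp: bounded_iff)
  have "cmod (indicator A z * g z) \<le> \<bar>K\<bar>" for z
    using K[of z] by (cases "z \<in> A") auto
  then show thesis by (rule that)
qed

text \<open>If the approximation were impossible, the constraints \<open>|f - g| \<le> 1/2\<close> on \<open>S\<close> and \<open>|g| \<le> 2\<close> on the
  torus, linearised with unimodular multipliers, would carry a mean that kills the algebra. The label
  \<open>l\<close> combines the multiplier (its phase) with the kind of constraint (its modulus, \<open>2\<close> or \<open>1/2\<close>).\<close>
lemma approximation_of_null_set: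
  fixes S :: "(complex^'n::finite) set"
  assumes S: "compact S" "S \<subseteq> torus"
    and null: "null_set_for (annihilator polydisc_algebra) S"
    and f: "continuous_on S f" "\<And>z. z \<in> S \<Longrightarrow> cmod (f z) \<le> 1"
  shows "\<exists>g\<in>polydisc_algebra. (\<forall>z\<in>torus. cmod (g z) \<le> 2) \<and> (\<forall>z\<in>S. cmod (f z - g z) \<le> 1/2)"
proof (rule ccontr)
  assume contr: "\<not> ?thesis"
  define X where "X = sphere (0::complex) 2 \<times> S \<union> sphere 0 (1/2) \<times> torus"
  have "compact X"
    unfolding X_def by (intro compact_Un compact_Times S compact_torus compact_sphere)
  \<comment> \<open>With this \<open>F\<close> both kinds of constraint read
    \<open>F (l, z) - Re (l * g z) \<le> 1\<close>. As the phase of \<open>l\<close> varies, modulus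
    \<open>2\<close> gives \<open>cmod (f z - g z) \<le> 1/2\<close> and modulus \<open>1/2\<close>
    gives \<open>cmod (g z) \<le> 2\<close>.\<close>
  define F where "F p = (if cmod (fst p) = 2 then Re (fst p * f (snd p)) else 0)"
    for p :: "complex \<times> (complex^'n)"
  have contF: "continuous_on X F"
    unfolding X_def
  proof (rule continuous_on_closed_Un)
    show "closed (sphere (0::complex) 2 \<times> S)" "closed (sphere (0::complex) (1/2) \<times> (torus :: (complex^'n) set))"
      by (intro closed_Times closed_sphere closed_torus compact_imp_closed[OF S(1)])+
    have "continuous_on (sphere (0::complex) 2 \<times> S) (\<lambda>p. Re (fst p * f (snd p)))"
      by (intro continuous_intros continuous_on_compose2[OF f(1)]) auto
    then show "continuous_on (sphere 0 2 \<times> S) F"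
      by (rule continuous_on_eq) (auto simp: F_def)
    show "continuous_on (sphere 0 (1/2) \<times> torus) F"
      by (rule continuous_on_eq[OF continuous_on_const[of _ 0]]) (auto simp: F_def)
  qed
  \<comment> \<open>The constraints are made homogeneous by \<open>t\<close> to obtain a linear
    space: for \<open>t > 0\<close>, negativity of \<open>v t g\<close> says that
    \<open>- g / t\<close> satisfies them strictly.\<close>
  define v where "v t g p = t * (F p - 1) + Re (fst p * g (snd p))" for t g p
  have sndX: "snd ` X \<subseteq> closed_polydisc" "snd p \<in> torus" if "p \<in> X" for p
    using that S(2) torus_subset_closed_polydisc by (auto simp: X_def)
  have contv: "continuous_on X (v t g)" if "g \<in> polydisc_algebra" for t g
    unfolding v_def
    by (intro continuous_intros contF continuous_on_compose2[OF polydisc_algebra_continuous[OF that]])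
      (use sndX in auto)
  have "\<exists>\<Phi>. mean X \<Phi> \<and> (\<forall>w\<in>{v t g |t g. g \<in> polydisc_algebra}. \<Phi> w = 0)"
  proof (rule exists_mean)
    show "bounded (w ` X)" if "w \<in> {v t g |t g. g \<in> polydisc_algebra}" for w
      using that compact_imp_bounded[OF compact_continuous_image[OF contv \<open>compact X\<close>]] by auto
    show "{v t g |t g. g \<in> polydisc_algebra} \<noteq> {}"
      using polydisc_algebra_const by blast
  next
    fix w w' assume "w \<in> {v t g |t g. g \<in> polydisc_algebra}" "w' \<in> {v t g |t g. g \<in> polydisc_algebra}"
    then obtain t g t' g' where "g \<in> polydisc_algebra" "g' \<in> polydisc_algebra"
      and w: "w = v t g" "w' = v t' g'"
      by blast
    then have "(\<lambda>z. g z + g' z) \<in> polydisc_algebra" by (intro polydisc_algebra_add)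
    moreover have "(\<lambda>p. w p + w' p) = v (t + t') (\<lambda>z. g z + g' z)"
      by (auto simp: w v_def algebra_simps)
    ultimately show "(\<lambda>p. w p + w' p) \<in> {v t g |t g. g \<in> polydisc_algebra}" by blast
  next
    fix w c assume "w \<in> {v t g |t g. g \<in> polydisc_algebra}"
    then obtain t g where "g \<in> polydisc_algebra" and w: "w = v t g" by blast
    then have "(\<lambda>z. complex_of_real c * g z) \<in> polydisc_algebra" by (intro polydisc_algebra_cmult)
    moreover have "(\<lambda>p. c * w p) = v (c * t) (\<lambda>z. complex_of_real c * g z)"
      by (auto simp: w v_def algebra_simps)
    ultimately show "(\<lambda>p. c * w p) \<in> {v t g |t g. g \<in> polydisc_algebra}" by blast
  next
    fix w and e :: real assume "w \<in> {v t g |t g. g \<in> polydisc_algebra}" and e: "0 < e"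
    then obtain t g where g: "g \<in> polydisc_algebra" and w: "w = v t g" by blast
    show "\<exists>p\<in>X. - e < w p"
    proof (rule ccontr)
      assume neg: "\<not> (\<exists>p\<in>X. - e < w p)"
      have neg: "t * (F (l, z) - 1) + Re (l * g z) \<le> - e" if "(l, z) \<in> X" for l z
      proof -
        have "\<not> - e < w (l, z)" using neg that by blast
        then show ?thesis by (simp add: w v_def)
      qed
      show False
      \<comment> \<open>For \<open>t > 0\<close> the excluded approximant appears. Otherwise the
        labels \<open>1/2\<close> and \<open>- 1/2\<close> at one torus point, where
        \<open>F\<close> vanishes, give two inequalities whose sum is absurd.\<close>
      proof (cases "t > 0")
        case True
        define G where "G = (\<lambda>z. complex_of_real (- 1 / t) * g z)"
        have G: "G \<in> polydisc_algebra"
          unfolding G_def by (rule polydisc_algebra_cmult[OF g])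
        have lin: "F (l, z) - Re (l * G z) < 1" if "(l, z) \<in> X" for l z
        proof -
          have "t * (F (l, z) - 1) + Re (l * g z) < 0" using neg[OF that] e by linarith
          then have "(t * (F (l, z) - 1) + Re (l * g z)) / t < 0"
            using True by (simp add: divide_neg_pos)
          moreover have "(t * (F (l, z) - 1) + Re (l * g z)) / t = F (l, z) - 1 - Re (l * G z)"
            using True by (simp add: G_def field_simps)
          ultimately show ?thesis by linarith
        qed
        have unimodular: "\<exists>u. cmod u = 1 \<and> u * a = complex_of_real (cmod a)" for a
        proof (cases "a = 0")
          case False
          have "cnj a * a = complex_of_real ((cmod a)\<^sup>2)"
            by (simp only: complex_norm_square mult.commute)
          then show ?thesis using False
            by (intro exI[of _ "cnj a / cmod a"]) (simp add: norm_divide power2_eq_square)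
        qed (auto intro: exI[of _ 1])
        have "cmod (G z) \<le> 2" if z: "z \<in> torus" for z
        proof -
          obtain u where u: "cmod u = 1" "u * G z = cmod (G z)" using unimodular by blast
          have "(- u / 2, z) \<in> X" using u z by (simp add: X_def norm_divide)
          from lin[OF this] have "Re (u * G z) < 2" using u by (simp add: F_def norm_divide)
          then show ?thesis using u by simp
        qed
        moreover have "cmod (f z - G z) \<le> 1/2" if z: "z \<in> S" for z
        proof -
          obtain u where u: "cmod u = 1" "u * (f z - G z) = cmod (f z - G z)"
            using unimodular by blast
          have "(2 * u, z) \<in> X" using u z by (simp add: X_def norm_mult)
          from lin[OF this] have "2 * Re (u * (f z - G z)) < 1"
            using u(1) by (simp add: F_def norm_mult algebra_simps)
          then show ?thesis unfolding u(2) by simp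
        qed
        ultimately show False using contr G by blast
      next
        case False
        obtain z :: "complex^'n" where "z \<in> torus" using torus_nonempty by blast
        then have "(1/2, z) \<in> X" "(- (1/2), z) \<in> X" by (auto simp: X_def norm_divide)
        from neg[OF this(1)] neg[OF this(2)] show False
          using False e by (simp add: F_def norm_divide)
      qed
    qed
  qed
  then obtain \<Phi> where "mean X \<Phi>" and \<Phi>v: "\<And>t g. g \<in> polydisc_algebra \<Longrightarrow> \<Phi> (v t g) = 0"
    by blast
  obtain Y where Y: "Y \<in> borel_measurable borel" and YX: "\<And>t::real. Y t \<in> X"
    and intY: "\<And>w. continuous_on X w \<Longrightarrow> (\<integral>t. indicator {0..<1} t * w (Y t) \<partial>lborel) = \<Phi> w"
    using skorokhod_representation[OF \<open>compact X\<close> \<open>mean X \<Phi>\<close>] by blast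
  \<comment> \<open>On this probability space \<open>Y\<close> is a random pair of label and point
    whose expectations are the values of the mean.\<close>
  define \<Omega> where "\<Omega> = restrict_space lborel {0..<1::real}"
  have emeasure: "emeasure \<Omega> (space \<Omega>) = 1"
    by (simp add: \<Omega>_def emeasure_restrict_space space_restrict_space)
  interpret finite_measure \<Omega> by (rule finite_measureI) (simp add: emeasure)
  have int\<Omega>: "(\<integral>t. w (Y t) \<partial>\<Omega>) = \<Phi> w" if "continuous_on X w" for w
    using intY[OF that] by (simp add: \<Omega>_def integral_restrict_space)
  have Y\<Omega>: "Y \<in> borel_measurable \<Omega>"
    using Y by (simp add: \<Omega>_def measurable_restrict_space1)
  define l where "l t = fst (Y t)" for t
  define x where "x t = snd (Y t)" for t
  have l: "l \<in> borel_measurable \<Omega>" and x: "x \<in> borel_measurable \<Omega>"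
    unfolding l_def x_def
    by (rule measurable_compose[OF Y\<Omega>], intro borel_measurable_continuous_onI continuous_intros)+
  have lx: "cmod (l t) = 2 \<and> x t \<in> S \<or> cmod (l t) = 1/2 \<and> x t \<in> torus" for t
    using YX[of t] by (cases "Y t") (auto simp: X_def l_def x_def)
  have x_torus: "x t \<in> torus" and l2: "cmod (l t) \<le> 2" for t
    using lx[of t] S(2) by auto
  \<comment> \<open>\<open>M\<close> is the law of the point, and \<open>h\<close> times
    \<open>M\<close> the push-forward of \<open>l\<close> times \<open>\<Omega>\<close>; this is the
    measure that will annihilate the algebra.\<close>
  define M where "M = distr \<Omega> borel x"
  obtain h where h: "integrable M h"
    and inth: "\<And>\<phi> K. \<phi> \<in> borel_measurable borel \<Longrightarrow> (\<And>y. cmod (\<phi> y) \<le> K) \<Longrightarrow>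
      (\<integral>y. \<phi> y * h y \<partial>M) = (\<integral>t. \<phi> (x t) * l t \<partial>\<Omega>)"
    using exists_pushforward_density[OF finite_measure_axioms x l l2] unfolding M_def by blast

  have "cm_integral M h g = 0" if g: "g \<in> polydisc_algebra" for g
  proof -
    have cont: "continuous_on torus g"
      by (rule continuous_on_subset[OF polydisc_algebra_continuous[OF g] torus_subset_closed_polydisc])
    obtain K where K: "\<And>z. cmod (indicator torus z * g z) \<le> K"
      using continuous_on_compact_bound[OF compact_torus cont] by blast
    have meas: "(\<lambda>z. indicator torus z * g z) \<in> borel_measurable borel"
      by (rule borel_measurable_indicator_mult[OF closed_torus cont])
    have "cm_integral M h g = (\<integral>t. indicator torus (x t) * g (x t) * l t \<partial>\<Omega>)"
      unfolding cm_integral_def by (rule inth[OF meas K])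
    also have "\<dots> = (\<integral>t. l t * g (x t) \<partial>\<Omega>)"
      by (intro Bochner_Integration.integral_cong refl) (simp add: x_torus)
    also have "\<dots> = 0"
    proof (rule complex_eqI)
      have int: "integrable \<Omega> (\<lambda>t. l t * g (x t))"
      proof (rule integrable_const_bound[of _ "2 * K"])
        have "(\<lambda>t. l t * (indicator torus (x t) * g (x t))) \<in> borel_measurable \<Omega>"
          by (intro borel_measurable_times l measurable_compose[OF x meas])
        then show "(\<lambda>t. l t * g (x t)) \<in> borel_measurable \<Omega>" by (simp add: x_torus)
        have "cmod (l t * g (x t)) \<le> 2 * K" for t
          unfolding norm_mult using K[of "x t"] by (intro mult_mono l2) (simp_all add: x_torus)
        then show "AE t in \<Omega>. cmod (l t * g (x t)) \<le> 2 * K" by (rule AE_I2)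
      qed
      \<comment> \<open>The functions \<open>v 0 g'\<close> control real parts only; the imaginary
        part follows by inserting \<open>- \<i> * g\<close>.\<close>
      have zero: "(\<integral>t. Re (l t * g' (x t)) \<partial>\<Omega>) = 0" if "g' \<in> polydisc_algebra" for g'
        using int\<Omega>[OF contv[OF that, of 0]] \<Phi>v[OF that, of 0] by (simp add: v_def l_def x_def)
      show "Re (\<integral>t. l t * g (x t) \<partial>\<Omega>) = Re 0"
        using zero[OF g] integral_Re[OF int] by simp
      have "(\<integral>t. Im (l t * g (x t)) \<partial>\<Omega>) = (\<integral>t. Re (l t * (- \<i> * g (x t))) \<partial>\<Omega>)"
        by (intro Bochner_Integration.integral_cong refl) simp
      also have "\<dots> = 0" using zero[OF polydisc_algebra_cmult[OF g, of "- \<i>"]] .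
      finally show "Im (\<integral>t. l t * g (x t) \<partial>\<Omega>) = Im 0"
        using integral_Im[OF int] by simp
    qed
    finally show ?thesis .
  qed
  moreover have "cmeasure_rep M h"
    unfolding cmeasure_rep_def
  proof (intro conjI h)
    show "finite_measure M" unfolding M_def by (rule finite_measure_distr[OF x])
    show "sets M = sets borel" by (simp add: M_def)
    have "x -` (UNIV - torus) \<inter> space \<Omega> = {}" using x_torus by auto
    moreover have "UNIV - torus \<in> sets (borel :: (complex^'n) measure)"
      using borel_closed[OF closed_torus] by (metis borel_comp Compl_eq_Diff_UNIV)
    ultimately show "emeasure M (UNIV - torus) = 0"
      unfolding M_def by (subst emeasure_distr[OF x]) auto
  qed
  ultimately have "(M, h) \<in> annihilator polydisc_algebra" by (simp add: annihilator_def)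
  then have tv: "(\<integral>z. indicator S z * cmod (h z) \<partial>M) = 0"
    using null unfolding null_set_for_def total_variation_def by blast
  have closedS: "closed S" by (rule compact_imp_closed[OF S(1)])
  have "integrable M (\<lambda>z. indicator S z * cmod (h z))"
    using integrable_mult_indicator[OF _ integrable_norm[OF h], of S] closedS
    by (simp add: M_def)
  then have AE: "AE z in M. indicator S z * cmod (h z) = 0"
    using tv by (subst (asm) integral_nonneg_eq_0_iff_AE) auto
  have meas: "(\<lambda>z. indicator S z * f z) \<in> borel_measurable borel"
    by (rule borel_measurable_indicator_mult[OF closedS f(1)])
  have ind_le: "cmod (indicator S z * f z) \<le> 1" for z
    using f(2)[of z] by (auto simp: indicator_def)
  \<comment> \<open>As \<open>S\<close> is null, \<open>h\<close> vanishes almost everywhere on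
    \<open>S\<close>; pulled back to \<open>\<Omega>\<close>, this says that \<open>f\<close>
    integrates to zero against the labels over the event that the point lies in
    \<open>S\<close>.\<close>
  have "(\<integral>t. indicator S (x t) * f (x t) * l t \<partial>\<Omega>) = (\<integral>z. indicator S z * f z * h z \<partial>M)"
    by (rule inth[OF meas ind_le, symmetric])
  also have "\<dots> = 0"
    using AE by (intro integral_eq_zero_AE) (auto simp: indicator_def split: if_splits)
  finally have zero: "(\<integral>t. indicator S (x t) * f (x t) * l t \<partial>\<Omega>) = 0" .
  have intc: "integrable \<Omega> (\<lambda>t. indicator S (x t) * f (x t) * l t)"
    by (rule integrable_bounded_mult[OF _ measurable_compose[OF x meas] ind_le])
      (rule integrable_const_bound[OF AE_I2[OF l2] l])
  have int: "integrable \<Omega> (\<lambda>t. Re (indicator S (x t) * f (x t) * l t))"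
    and intRe: "(\<integral>t. Re (indicator S (x t) * f (x t) * l t) \<partial>\<Omega>) = 0"
    by (rule integrable_Re[OF intc]) (simp only: integral_Re[OF intc] zero zero_complex.sel)
  \<comment> \<open>For modulus \<open>2\<close> this reduces to \<open>- 1 \<le> - 1/2\<close>. For
    modulus \<open>1/2\<close> the point may also lie in \<open>S\<close>, but the real part is then
    at least \<open>- 1/2\<close>. Integrating bounds the mean by \<open>- 1/2\<close>, although it
    is \<open>0\<close>.\<close>
  have "v 1 (\<lambda>_. 0) (Y t) \<le> Re (indicator S (x t) * f (x t) * l t) - 1/2" for t
  proof -
    have "F (Y t) - 1 \<le> Re (indicator S (x t) * f (x t) * l t) - 1/2"
      using lx[of t]
    proof
      assume "cmod (l t) = 2 \<and> x t \<in> S"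
      then show ?thesis by (simp add: F_def l_def x_def mult.commute)
    next
      assume a: "cmod (l t) = 1/2 \<and> x t \<in> torus"
      have "cmod (indicator S (x t) * f (x t) * l t) \<le> 1 * (1/2)"
        unfolding norm_mult[of _ "l t"] using ind_le[of "x t"] a by (intro mult_mono) auto
      then have "- (1/2) \<le> Re (indicator S (x t) * f (x t) * l t)"
        using abs_Re_le_cmod[of "indicator S (x t) * f (x t) * l t"] by linarith
      moreover have "F (Y t) = 0" using a by (simp add: F_def l_def)
      ultimately show ?thesis by linarith
    qed
    then show ?thesis by (simp add: v_def)
  qed
  moreover have contv1: "continuous_on X (v 1 (\<lambda>_. 0))" by (rule contv[OF polydisc_algebra_const])
  moreover have "integrable \<Omega> (\<lambda>t. v 1 (\<lambda>_. 0) (Y t))"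
  proof -
    obtain K where "\<And>p. p \<in> X \<Longrightarrow> \<bar>v 1 (\<lambda>_. 0) p\<bar> \<le> K"
      using compact_imp_bounded[OF compact_continuous_image[OF contv1 \<open>compact X\<close>]]
      by (auto simp: bounded_iff)
    moreover have "(\<lambda>t. v 1 (\<lambda>_. 0) (Y t)) \<in> borel_measurable \<Omega>"
    proof (rule measurable_compose[of Y _ "restrict_space borel X"])
      show "Y \<in> measurable \<Omega> (restrict_space borel X)"
        using Y\<Omega> YX by (intro measurable_restrict_space2) auto
      show "v 1 (\<lambda>_. 0) \<in> borel_measurable (restrict_space borel X)"
        by (rule borel_measurable_continuous_on_restrict[OF contv1])
    qed
    ultimately show ?thesis using YX by (intro integrable_const_bound[of _ K]) auto
  qed
  ultimately have "(\<integral>t. v 1 (\<lambda>_. 0) (Y t) \<partial>\<Omega>)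
      \<le> (\<integral>t. Re (indicator S (x t) * f (x t) * l t) - 1/2 \<partial>\<Omega>)"
    using int by (intro integral_mono) auto
  also have "\<dots> = - 1/2" using int intRe by (simp add: measure_def emeasure)
  finally show False
    using int\<Omega>[OF contv1] \<Phi>v[OF polydisc_algebra_const, of 1 0] by simp
qed

text \<open>Rescaling moves \<open>f\<close> into the unit ball, where successive approximation
  applies with \<open>B = 2\<close>.\<close>

lemma interpolation_of_null_set:
  fixes S :: "(complex^'n::finite) set"
  assumes S: "compact S" "S \<subseteq> torus" and null: "null_set_for (annihilator polydisc_algebra) S"
  shows "interpolation_set polydisc_algebra S"
  unfolding interpolation_set_def
proof (intro allI impI)
  fix f :: "complex^'n \<Rightarrow> complex" assume f: "continuous_on S f"
  obtain K where K: "K > 0" "\<And>z. z \<in> S \<Longrightarrow> cmod (f z) \<le> K"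
    using compact_imp_bounded[OF compact_continuous_image[OF f S(1)]] by (auto simp: bounded_pos)
  define F where "F z = complex_of_real (1 / K) * f z" for z
  have contF: "continuous_on S F" unfolding F_def by (intro continuous_intros f)
  have F1: "cmod (F z) \<le> 1" if "z \<in> S" for z
    using K(2)[OF that] K(1) by (simp add: F_def norm_mult norm_divide)
  obtain g where g: "g \<in> polydisc_algebra" "\<And>z. z \<in> S \<Longrightarrow> g z = F z"
    using interpolation_of_approximation[OF S(2) approximation_of_null_set[OF S null] contF F1] by blast
  have "(\<lambda>z. complex_of_real K * g z) \<in> polydisc_algebra" by (rule polydisc_algebra_cmult[OF g(1)])
  moreover have "complex_of_real K * g z = f z" if "z \<in> S" for z
    using g(2)[OF that] K(1) by (simp add: F_def)
  ultimately show "\<exists>g\<in>polydisc_algebra. \<forall>z\<in>S. g z = f z" 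
    by (intro bexI[of _ "\<lambda>z. complex_of_real K * g z"]) auto
qed

section \<open>Interpolation sets are null sets\<close>

text \<open>An open mapping argument: the sets \<open>D n\<close> of functions with an interpolant
  bounded by \<open>n\<close> cover the space, so the closure of one contains a ball. Subtracting
  its centre gives approximate interpolation with a uniform bound, which successive approximation
  makes exact.\<close>

lemma interpolation_constant:
  fixes S :: "(complex^'n::finite) set"
  assumes S: "compact S" "S \<subseteq> torus" and interp: "interpolation_set polydisc_algebra S"
  obtains C where "\<And>f. continuous_on S f \<Longrightarrow> (\<And>z. z \<in> S \<Longrightarrow> cmod (f z) \<le> 1) \<Longrightarrow>
    \<exists>g\<in>polydisc_algebra. (\<forall>z\<in>torus. cmod (g z) \<le> C) \<and> (\<forall>z\<in>S. g z = f z)"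
proof -
  \<comment> \<open>Baire's theorem is applied to the bounded continuous functions on the whole
    space, a complete metric space; Tietze extension embeds the unit ball of \<open>C(S)\<close>
    into it.\<close>
  define D :: "nat \<Rightarrow> ((complex^'n) \<Rightarrow>\<^sub>C complex) set" where
    "D n = {\<phi>. \<exists>g\<in>polydisc_algebra. (\<forall>z\<in>torus. cmod (g z) \<le> real n) \<and> (\<forall>z\<in>S. g z = apply_bcontfun \<phi> z)}" for n
  have cover: "\<phi> \<in> (\<Union>n. D n)" for \<phi>
  proof -
    obtain g where g: "g \<in> polydisc_algebra" "\<And>z. z \<in> S \<Longrightarrow> g z = apply_bcontfun \<phi> z"
      using interp continuous_on_apply_bcontfun[of S \<phi>] unfolding interpolation_set_def by blast
    have "continuous_on torus g"
      by (rule continuous_on_subset[OF polydisc_algebra_continuous[OF g(1)] torus_subset_closed_polydisc])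
    then obtain K where K: "\<And>z. cmod (indicator torus z * g z) \<le> K"
      using continuous_on_compact_bound[OF compact_torus] by blast
    obtain n where n: "K \<le> real n" using real_arch_simple by blast
    have "cmod (g z) \<le> real n" if "z \<in> torus" for z using K[of z] n that by simp
    then show ?thesis using g unfolding D_def by blast
  qed
  have "\<exists>n. interior (closure (D n)) \<noteq> {}"
  proof (rule ccontr)
    assume empty: "\<nexists>n. interior (closure (D n)) \<noteq> {}"
    have "Met_TC.mtopology interior_of \<Union> (range (\<lambda>n. closure (D n))) = {}"
      using empty by (intro Met_TC.metric_Baire_category_alt)
        (auto simp: mcomplete_iff_complete complete_UNIV)
    moreover have "\<Union> (range (\<lambda>n. closure (D n))) = UNIV"
      using cover closure_subset by fastforce
    ultimately show False by simp
  qed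
  then obtain n \<phi>0 where "\<phi>0 \<in> interior (closure (D n))" by blast
  then obtain r where r: "r > 0" "cball \<phi>0 r \<subseteq> closure (D n)"
    using mem_interior_cball by blast
  \<comment> \<open>The tolerance \<open>r / 4\<close> is chosen because two such errors, divided by
    \<open>r\<close>, add up to \<open>1/2\<close>.\<close>
  have near: "\<exists>g\<in>polydisc_algebra. (\<forall>z\<in>torus. cmod (g z) \<le> real n) \<and>
      (\<forall>z\<in>S. cmod (apply_bcontfun \<phi> z - g z) \<le> r / 4)" if "\<phi> \<in> cball \<phi>0 r" for \<phi>
  proof -
    have "\<phi> \<in> closure (D n)" using that r by blast
    then obtain \<psi> where \<psi>: "\<psi> \<in> D n" "dist \<psi> \<phi> < r / 4"
      using closure_approachable[of \<phi> "D n"] r(1) by (metis zero_less_divide_iff zero_less_numeral)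
    then obtain g where g: "g \<in> polydisc_algebra" "\<And>z. z \<in> torus \<Longrightarrow> cmod (g z) \<le> real n"
      "\<And>z. z \<in> S \<Longrightarrow> g z = apply_bcontfun \<psi> z"
      unfolding D_def by blast
    have "cmod (apply_bcontfun \<phi> z - g z) \<le> r / 4" if "z \<in> S" for z
      using dist_bounded[of \<phi> z \<psi>] \<psi>(2) g(3)[OF that]
      by (simp add: dist_norm[symmetric] dist_commute)
    then show ?thesis using g by blast
  qed
  have approx: "\<exists>g\<in>polydisc_algebra. (\<forall>z\<in>torus. cmod (g z) \<le> 2 * real n / r) \<and>
      (\<forall>z\<in>S. cmod (f z - g z) \<le> 1/2)"
    if f: "continuous_on S f" "\<And>z. z \<in> S \<Longrightarrow> cmod (f z) \<le> 1" for f
  proof -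
    have "closedin (top_of_set UNIV) S" using S(1) by (simp add: compact_imp_closed)
    then obtain F where F: "continuous_on UNIV F" "\<And>z. z \<in> S \<Longrightarrow> F z = f z"
      "\<And>z. cmod (F z) \<le> 1"
      using Tietze[OF f(1) _ zero_le_one f(2)] by (metis UNIV_I)
    then have "F \<in> bcontfun" by (intro bcontfun_normI)
    then obtain \<phi> where \<phi>: "F = apply_bcontfun \<phi>" by (rule bcontfunE)
    have "norm \<phi> \<le> 1" using F(3) unfolding \<phi> by (intro norm_bound)
    then have in_ball: "\<phi>0 + r *\<^sub>R \<phi> \<in> cball \<phi>0 r" "\<phi>0 \<in> cball \<phi>0 r"
      using r(1) by (auto simp: dist_norm mult_left_le)
    obtain g1 where g1: "g1 \<in> polydisc_algebra" "\<And>z. z \<in> torus \<Longrightarrow> cmod (g1 z) \<le> real n"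
      "\<And>z. z \<in> S \<Longrightarrow> cmod (apply_bcontfun \<phi>0 z + r *\<^sub>R apply_bcontfun \<phi> z - g1 z) \<le> r / 4"
      using near[OF in_ball(1)] by (auto simp: plus_bcontfun.rep_eq scaleR_bcontfun.rep_eq)
    obtain g0 where g0: "g0 \<in> polydisc_algebra" "\<And>z. z \<in> torus \<Longrightarrow> cmod (g0 z) \<le> real n"
      "\<And>z. z \<in> S \<Longrightarrow> cmod (apply_bcontfun \<phi>0 z - g0 z) \<le> r / 4"
      using near[OF in_ball(2)] by blast
    \<comment> \<open>A difference quotient: on \<open>S\<close>, \<open>g1\<close> and
      \<open>g0\<close> approximate \<open>\<phi>0 + r *\<^sub>R \<phi>\<close> and the centre
      \<open>\<phi>0\<close>.\<close>
    define g where "g = (\<lambda>z. complex_of_real (1 / r) * (g1 z - g0 z))"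
    have "g \<in> polydisc_algebra"
      unfolding g_def by (intro polydisc_algebra_cmult polydisc_algebra_diff g1 g0)
    moreover have "cmod (g z) \<le> 2 * real n / r" if "z \<in> torus" for z
    proof -
      have "cmod (g1 z - g0 z) \<le> 2 * real n"
        using norm_triangle_ineq4[of "g1 z" "g0 z"] g1(2)[OF that] g0(2)[OF that] by linarith
      then show ?thesis using r(1)
        by (simp add: g_def norm_mult norm_divide divide_right_mono)
    qed
    moreover have "cmod (f z - g z) \<le> 1/2" if "z \<in> S" for z
    proof -
      have "f z = apply_bcontfun \<phi> z" using F(2)[OF that] \<phi> by simp
      then have "f z - g z = complex_of_real (1 / r) *
          ((apply_bcontfun \<phi>0 z + r *\<^sub>R apply_bcontfun \<phi> z - g1 z) - (apply_bcontfun \<phi>0 z - g0 z))"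
        using r(1) by (simp add: g_def scaleR_conv_of_real field_simps)
      then have "cmod (f z - g z) = 1 / r *
          cmod ((apply_bcontfun \<phi>0 z + r *\<^sub>R apply_bcontfun \<phi> z - g1 z) - (apply_bcontfun \<phi>0 z - g0 z))"
        using r(1) by (simp only: norm_mult norm_of_real) simp
      also have "\<dots> \<le> 1 / r * (r / 4 + r / 4)"
        by (intro mult_left_mono
            order_trans[OF norm_triangle_ineq4 add_mono[OF g1(3)[OF that] g0(3)[OF that]]])
          (use r(1) in simp)
      also have "\<dots> = 1/2" using r(1) by simp
      finally show ?thesis .
    qed
    ultimately show ?thesis by blast
  qed
  show thesis
    by (rule that[of "2 * (2 * real n / r)"])
      (rule interpolation_of_approximation[OF S(2) approx])
qed

text \<open>On the torus \<open>Re z\<^sub>i\<close> and \<open>Im z\<^sub>i\<close> are trigonometric polynomials, whose negative powers are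
  removed by a power of the product of all coordinates.\<close>
lemma real_polynomial_torus:
  fixes \<phi> :: "complex^'n::finite \<Rightarrow> real"
  assumes "real_polynomial_function \<phi>"
  shows "\<exists>m. \<exists>p\<in>polydisc_algebra. \<forall>z\<in>torus. complex_of_real (\<phi> z) * (\<Prod>i\<in>UNIV. z$i) ^ m = p z"
  using assms
proof (induction rule: real_polynomial_function.induct)
  case (linear \<phi>)
  interpret bounded_linear \<phi> by fact
  define a where "a i = complex_of_real (\<phi> (axis i 1))" for i
  define b where "b i = complex_of_real (\<phi> (axis i \<i>))" for i
  define e where "e = (\<lambda>z::complex^'n. \<Prod>i\<in>UNIV. z$i)"
  \<comment> \<open>On the torus \<open>e' i z = cnj (z$i) * e z\<close>, so one factor
    \<open>e\<close> already clears the conjugates in \<open>Re (z$i)\<close> and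
    \<open>Im (z$i)\<close>; this gives exponent \<open>1\<close>.\<close>
  define e' where "e' i = (\<lambda>z::complex^'n. \<Prod>j\<in>UNIV - {i}. z$j)" for i
  have \<phi>: "complex_of_real (\<phi> z) = (\<Sum>i\<in>UNIV. a i * Re (z$i) + b i * Im (z$i))" for z
  proof -
    have "z = (\<Sum>i\<in>UNIV. axis i (z$i))"
      by (simp add: vec_eq_iff axis_def sum.delta)
    then have "\<phi> z = (\<Sum>i\<in>UNIV. \<phi> (axis i (z$i)))" using sum by metis
    also have "\<dots> = (\<Sum>i\<in>UNIV. Re (z$i) * \<phi> (axis i 1) + Im (z$i) * \<phi> (axis i \<i>))"
    proof (rule Groups_Big.sum.cong[OF refl])
      fix i
      have "axis i (z$i) = Re (z$i) *\<^sub>R axis i 1 + Im (z$i) *\<^sub>R axis i \<i>"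
        by (simp add: vec_eq_iff axis_def complex_eq_iff)
      then show "\<phi> (axis i (z$i)) = Re (z$i) * \<phi> (axis i 1) + Im (z$i) * \<phi> (axis i \<i>)"
        by (simp only: add scaleR real_scaleR_def)
    qed
    finally show ?thesis by (simp add: a_def b_def mult.commute)
  qed
  define p where "p = (\<lambda>z. \<Sum>i\<in>UNIV. a i / 2 * (z$i * e z + e' i z)
      + b i / (2 * \<i>) * (z$i * e z - e' i z))"
  have "p \<in> polydisc_algebra"
    unfolding p_def e_def e'_def
    by (intro polydisc_algebra_sum polydisc_algebra_add polydisc_algebra_cmult polydisc_algebra_diff
        polydisc_algebra_mult polydisc_algebra_prod polydisc_algebra_component)
  moreover have "complex_of_real (\<phi> z) * (\<Prod>i\<in>UNIV. z$i) ^ 1 = p z" if z: "z \<in> torus" for z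
  proof -
    have "(a i * Re (z$i) + b i * Im (z$i)) * e z
        = a i / 2 * (z$i * e z + e' i z) + b i / (2 * \<i>) * (z$i * e z - e' i z)" for i
    proof -
      have "z$i * cnj (z$i) = 1"
        using z by (simp add: torus_def complex_norm_square[symmetric])
      moreover have "e z = z$i * e' i z"
        unfolding e_def e'_def by (rule prod.remove) auto
      ultimately have e': "e' i z = cnj (z$i) * e z" by (simp add: mult.commute mult.left_commute)
      have Re: "complex_of_real (Re (z$i)) = (z$i + cnj (z$i)) / 2"
        by (simp add: complex_eq_iff)
      have Im: "complex_of_real (Im (z$i)) = (z$i - cnj (z$i)) / (2 * \<i>)"
        by (simp add: complex_eq_iff)
      show ?thesis unfolding e' Re Im by (simp add: field_simps)
    qed
    then show ?thesis unfolding e_def by (simp only: \<phi> power_one_right sum_distrib_right p_def e_def)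
  qed
  ultimately show ?case by blast
next
  case (const c)
  show ?case by (intro exI[of _ 0] bexI[OF _ polydisc_algebra_const[of "complex_of_real c"]]) simp
next
  case (add \<phi> \<psi>)
  then obtain m p k q where p: "p \<in> polydisc_algebra" "q \<in> polydisc_algebra"
    and eq: "\<And>z. z \<in> torus \<Longrightarrow> complex_of_real (\<phi> z) * (\<Prod>i\<in>UNIV. z$i) ^ m = p z"
    "\<And>z. z \<in> torus \<Longrightarrow> complex_of_real (\<psi> z) * (\<Prod>i\<in>UNIV. z$i) ^ k = q z"
    by metis
  have "(\<lambda>z. p z * (\<Prod>i\<in>UNIV. z$i) ^ k + q z * (\<Prod>i\<in>UNIV. z$i) ^ m) \<in> polydisc_algebra"
    by (intro polydisc_algebra_add polydisc_algebra_mult polydisc_algebra_power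
        polydisc_algebra_prod polydisc_algebra_component p)
  then show ?case
    by (intro exI[of _ "m + k"], rule bexI[rotated])
      (simp add: eq[symmetric] power_add algebra_simps)
next
  case (mult \<phi> \<psi>)
  then obtain m p k q where p: "p \<in> polydisc_algebra" "q \<in> polydisc_algebra"
    and eq: "\<And>z. z \<in> torus \<Longrightarrow> complex_of_real (\<phi> z) * (\<Prod>i\<in>UNIV. z$i) ^ m = p z"
    "\<And>z. z \<in> torus \<Longrightarrow> complex_of_real (\<psi> z) * (\<Prod>i\<in>UNIV. z$i) ^ k = q z"
    by metis
  have "(\<lambda>z. p z * q z) \<in> polydisc_algebra" by (intro polydisc_algebra_mult p)
  then show ?case
    by (intro exI[of _ "m + k"], rule bexI[rotated])
      (simp add: eq[symmetric] power_add algebra_simps)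
qed


lemma null_set_of_interpolation:
  fixes S :: "(complex^'n::finite) set"
  assumes S: "compact S" "S \<subseteq> torus" and interp: "interpolation_set polydisc_algebra S"
  shows "null_set_for (annihilator polydisc_algebra) S"
proof -
  obtain C where C: "\<And>f. continuous_on S f \<Longrightarrow> (\<And>z. z \<in> S \<Longrightarrow> cmod (f z) \<le> 1) \<Longrightarrow>
    \<exists>g\<in>polydisc_algebra. (\<forall>z\<in>torus. cmod (g z) \<le> C) \<and> (\<forall>z\<in>S. g z = f z)"
    using interpolation_constant[OF assms] by blast
  have lift: "\<exists>g\<in>polydisc_algebra. (\<forall>z\<in>S. g z = complex_of_real (\<phi> z)) \<and>
      (\<forall>z\<in>torus. cmod (g z) \<le> C * \<bar>\<phi> z\<bar>)"
    if \<phi>: "real_polynomial_function \<phi>" for \<phi>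
  proof -
    obtain m p where p: "p \<in> polydisc_algebra"
      and eq: "\<And>z. z \<in> torus \<Longrightarrow> complex_of_real (\<phi> z) * (\<Prod>i\<in>UNIV. z$i) ^ m = p z"
      using real_polynomial_torus[OF \<phi>] by blast
    have e1: "cmod ((\<Prod>i\<in>UNIV. z$i) ^ m) = 1" if "z \<in> torus" for z :: "complex^'n"
      using norm_prod_torus[OF that] by (simp add: norm_power)
    have "continuous_on S (\<lambda>z. inverse ((\<Prod>i\<in>UNIV. z$i) ^ m))"
    proof (intro continuous_intros ballI)
      fix z assume "z \<in> S"
      then have "cmod ((\<Prod>i\<in>UNIV. z$i) ^ m) = 1" using e1 S(2) by blast
      then show "(\<Prod>i\<in>UNIV. z$i) ^ m \<noteq> 0" by (metis norm_zero zero_neq_one)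
    qed
    moreover have "cmod (inverse ((\<Prod>i\<in>UNIV. z$i) ^ m)) \<le> 1" if "z \<in> S" for z :: "complex^'n"
      using e1[of z] S(2) that by (auto simp: norm_inverse)
    ultimately obtain u where u: "u \<in> polydisc_algebra" "\<And>z. z \<in> torus \<Longrightarrow> cmod (u z) \<le> C"
      "\<And>z. z \<in> S \<Longrightarrow> u z = inverse ((\<Prod>i\<in>UNIV. z$i) ^ m)"
      using C by blast
    have "cmod (u z * p z) \<le> C * \<bar>\<phi> z\<bar>" if z: "z \<in> torus" for z
    proof -
      have "cmod (p z) = \<bar>\<phi> z\<bar>" using e1[OF z] by (simp add: eq[OF z, symmetric] norm_mult)
      then show ?thesis using u(2)[OF z] by (simp add: norm_mult mult_right_mono)
    qed
    moreover have "u z * p z = complex_of_real (\<phi> z)" if "z \<in> S" for z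
    proof -
      have z: "z \<in> torus" using that S(2) by blast
      then have "(\<Prod>i\<in>UNIV. z$i) ^ m \<noteq> 0" using e1[OF z] by (metis norm_zero zero_neq_one)
      then show ?thesis by (simp add: u(3)[OF that] eq[OF z, symmetric])
    qed
    moreover have "(\<lambda>z. u z * p z) \<in> polydisc_algebra" by (intro polydisc_algebra_mult u p)
    ultimately show ?thesis by (intro bexI[of _ "\<lambda>z. u z * p z"]) auto
  qed
  have "total_variation M h S = 0" if Mh: "(M, h) \<in> annihilator polydisc_algebra" for M h
  proof -
    have "finite_measure M" and sets: "sets M = sets borel" and h: "integrable M h"
      and ann: "\<And>g. g \<in> polydisc_algebra \<Longrightarrow> cm_integral M h g = 0"
      using Mh by (auto simp: annihilator_def cmeasure_rep_def)
    then interpret finite_measure M by simp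
    have borel: "borel_measurable M = borel_measurable borel"
      by (rule measurable_cong_sets[OF sets refl])
    have space: "space M = UNIV" using sets_eq_imp_space_eq[OF sets] by simp
    have compact_zero: "(LINT z:E|M. h z) = 0" if E: "compact E" "E \<subseteq> S" for E
    proof (cases "E = {}")
      case True
      then show ?thesis by (simp add: set_lebesgue_integral_def)
    next
      case False
      have closedE: "closed E" by (rule compact_imp_closed[OF E(1)])
      \<comment> \<open>Continuous tents that equal \<open>1\<close> on \<open>E\<close> and shrink
        to its indicator; closedness of \<open>E\<close> gives the pointwise limit.\<close>
      define \<psi> where "\<psi> k z = max 0 (1 - real k * infdist z E)" for k z
      have "\<exists>\<phi>. real_polynomial_function \<phi> \<and> (\<forall>z\<in>torus. \<bar>\<psi> k z - \<phi> z\<bar> < inverse (Suc k))" for k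
        by (rule Stone_Weierstrass_real_polynomial_function[of torus "\<psi> k" "inverse (Suc k)"])
          (auto simp: \<psi>_def compact_torus intro!: continuous_intros)
      then obtain \<phi> where \<phi>: "\<And>k. real_polynomial_function (\<phi> k)"
        and \<phi>\<psi>: "\<And>k z. z \<in> torus \<Longrightarrow> \<bar>\<psi> k z - \<phi> k z\<bar> < inverse (Suc k)"
        by metis
      obtain g where g: "\<And>k. g k \<in> polydisc_algebra"
        and gS: "\<And>k z. z \<in> S \<Longrightarrow> g k z = complex_of_real (\<phi> k z)"
        and gT: "\<And>k z. z \<in> torus \<Longrightarrow> cmod (g k z) \<le> C * \<bar>\<phi> k z\<bar>"
        using lift[OF \<phi>] by metis
      have \<psi>lim: "(\<lambda>k. \<psi> k z) \<longlonglongrightarrow> indicator E z" for z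
      proof (cases "z \<in> E")
        case True
        then show ?thesis by (simp add: \<psi>_def)
      next
        case notin: False
        then have pos: "infdist z E > 0" using infdist_pos_not_in_closed[OF closedE False] by simp
        obtain k0 where k0: "inverse (infdist z E) < real k0" using reals_Archimedean2 by blast
        have "\<psi> k z = 0" if "k \<ge> k0" for k
        proof -
          have "1 < real k * infdist z E" using k0 pos that
            by (simp add: inverse_eq_divide pos_divide_less_eq)
              (meson less_le_trans mult_right_mono of_nat_mono infdist_nonneg)
          then show ?thesis by (simp add: \<psi>_def)
        qed
        then have "\<forall>\<^sub>F k in sequentially. \<psi> k z = 0" by (auto simp: eventually_sequentially)
        then show ?thesis using notin by (simp add: tendsto_eventually)
      qed
      have \<phi>lim: "(\<lambda>k. \<phi> k z) \<longlonglongrightarrow> indicator E z" if z: "z \<in> torus" for z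
      proof -
        have "(\<lambda>k. \<psi> k z - \<phi> k z) \<longlonglongrightarrow> 0"
          by (rule Lim_null_comparison[OF _ LIMSEQ_inverse_real_of_nat])
            (use \<phi>\<psi>[OF z] in \<open>auto intro!: always_eventually less_imp_le\<close>)
        from tendsto_diff[OF \<psi>lim[of z] this] show ?thesis by simp
      qed
      \<comment> \<open>On \<open>S\<close> the functions \<open>g k\<close> agree with
        \<open>\<phi> k\<close>. Off \<open>S\<close> only the bound
        \<open>C * \<bar>\<phi> k z\<bar>\<close> is known, but it tends to zero because
        \<open>E\<close> lies in \<open>S\<close>.\<close>
      have glim: "(\<lambda>k. g k z) \<longlonglongrightarrow> indicator E z" if z: "z \<in> torus" for z
      proof (cases "z \<in> S")
        case True
        have "(\<lambda>k. complex_of_real (\<phi> k z)) \<longlonglongrightarrow> complex_of_real (indicator E z)"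
          by (intro tendsto_of_real \<phi>lim z)
        moreover have "complex_of_real (indicator E z) = indicator E z" by (simp add: indicator_def)
        ultimately show ?thesis using gS[OF True] by simp
      next
        case False
        then have "z \<notin> E" using E(2) by blast
        then have "(\<lambda>k. C * \<bar>\<phi> k z\<bar>) \<longlonglongrightarrow> C * \<bar>0\<bar>"
          using \<phi>lim[OF z] by (intro tendsto_intros) simp
        then have "(\<lambda>k. g k z) \<longlonglongrightarrow> 0"
          using gT[OF z] by (intro Lim_null_comparison[of "\<lambda>k. g k z" "\<lambda>k. C * \<bar>\<phi> k z\<bar>"]) auto
        then show ?thesis using \<open>z \<notin> E\<close> by simp
      qed
      have gb: "cmod (g k z) \<le> \<bar>C\<bar> * 2" if z: "z \<in> torus" for k z
      proof -
        have "0 \<le> \<psi> k z" "\<psi> k z \<le> 1" by (auto simp: \<psi>_def infdist_nonneg)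
        moreover have "inverse (real (Suc k)) \<le> 1" by (simp add: inverse_le_1_iff)
        ultimately have "\<bar>\<phi> k z\<bar> \<le> 2" using \<phi>\<psi>[OF z, of k] by linarith
        then have "\<bar>C\<bar> * \<bar>\<phi> k z\<bar> \<le> \<bar>C\<bar> * 2" by (intro mult_left_mono) auto
        moreover have "C * \<bar>\<phi> k z\<bar> \<le> \<bar>C\<bar> * \<bar>\<phi> k z\<bar>" by (intro mult_right_mono) auto
        ultimately show ?thesis using gT[OF z, of k] by linarith
      qed
      have meas: "(\<lambda>z. indicator torus z * g k z * h z) \<in> borel_measurable M" for k
      proof (rule borel_measurable_times)
        have "continuous_on torus (g k)"
          by (rule continuous_on_subset[OF polydisc_algebra_continuous[OF g] torus_subset_closed_polydisc])
        then show "(\<lambda>z. indicator torus z * g k z) \<in> borel_measurable M"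
          unfolding borel by (rule borel_measurable_indicator_mult[OF closed_torus])
      qed (use h in auto)
      have "(\<lambda>k. \<integral>z. indicator torus z * g k z * h z \<partial>M) \<longlonglongrightarrow> (\<integral>z. indicator E z *\<^sub>R h z \<partial>M)"
      proof (rule integral_dominated_convergence[OF _ meas])
        have "E \<in> sets M" using closedE by (simp add: sets)
        then show "(\<lambda>z. indicator E z *\<^sub>R h z) \<in> borel_measurable M" using h by measurable
        show "integrable M (\<lambda>z. \<bar>C\<bar> * 2 * cmod (h z))" using h by simp
        show "AE z in M. (\<lambda>k. indicator torus z * g k z * h z) \<longlonglongrightarrow> indicator E z *\<^sub>R h z"
        proof (rule AE_I2)
          fix z
          show "(\<lambda>k. indicator torus z * g k z * h z) \<longlonglongrightarrow> indicator E z *\<^sub>R h z"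
          proof (cases "z \<in> torus")
            case True
            have "(\<lambda>k. g k z * h z) \<longlonglongrightarrow> indicator E z * h z"
              by (intro tendsto_intros glim True)
            moreover have "indicator E z *\<^sub>R h z = indicator E z * h z" by (simp add: indicator_def)
            ultimately show ?thesis using True by simp
          next
            case False
            then have "z \<notin> E" using E(2) S(2) by blast
            with False show ?thesis by simp
          qed
        qed
        show "AE z in M. norm (indicator torus z * g k z * h z) \<le> \<bar>C\<bar> * 2 * cmod (h z)" for k
        proof (rule AE_I2)
          fix z
          show "norm (indicator torus z * g k z * h z) \<le> \<bar>C\<bar> * 2 * cmod (h z)"
            using gb[of z k] by (cases "z \<in> torus") (auto simp: norm_mult mult_right_mono)
        qed
      qed
      moreover have "(\<integral>z. indicator torus z * g k z * h z \<partial>M) = 0" for k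
        using ann[OF g[of k]] by (simp add: cm_integral_def)
      ultimately have "(\<lambda>k::nat. 0) \<longlonglongrightarrow> (\<integral>z. indicator E z *\<^sub>R h z \<partial>M)" by simp
      then show ?thesis unfolding set_lebesgue_integral_def by (rule LIMSEQ_unique) simp
    qed
    have S_sets: "S \<in> sets M" using compact_imp_closed[OF S(1)] by (simp add: sets)
    have int_set: "set_integrable M A h" if "A \<in> sets M" for A
      unfolding set_integrable_def using h that by (rule integrable_mult_indicator[rotated])
    \<comment> \<open>Dynkin's argument extends the vanishing from compact subsets of
      \<open>S\<close> to Borel subsets: closed sets are stable under intersection, and the
      complement step subtracts from the integral over \<open>S\<close> itself.\<close>
    have zero: "(LINT z:S \<inter> B|M. h z) = 0" if B: "B \<in> sets borel" for B
    proof -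
      have "Int_stable (Collect closed :: (complex^'n) set set)" by (auto simp: Int_stable_def)
      moreover have "Collect closed \<subseteq> Pow (UNIV :: (complex^'n) set)" by simp
      moreover have "B \<in> sigma_sets UNIV (Collect closed)"
        using B unfolding borel_eq_closed by simp
      ultimately show ?thesis
      proof (induct rule: sigma_sets_induct_disjoint)
        case (basic A)
        then show ?case using S(1) by (intro compact_zero) auto
      next
        case empty
        then show ?case by (simp add: set_lebesgue_integral_def)
      next
        case (compl A)
        then have A: "A \<in> sets M" unfolding sets borel_eq_closed by simp
        have "(LINT z:(S \<inter> A) \<union> (S \<inter> (UNIV - A))|M. h z)
            = (LINT z:S \<inter> A|M. h z) + (LINT z:S \<inter> (UNIV - A)|M. h z)"
          using A S_sets sets.compl_sets[OF A] by (intro set_integral_Un int_set) (auto simp: space)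
        moreover have "(S \<inter> A) \<union> (S \<inter> (UNIV - A)) = S" by blast
        ultimately show ?case using compl(2) compact_zero[OF S(1)] by simp
      next
        case (union A)
        then have A: "\<And>i. A i \<in> sets M" unfolding sets borel_eq_closed by auto
        have "(LINT z:(\<Union>i. S \<inter> A i)|M. h z) = (\<Sum>i. LINT z:S \<inter> A i|M. h z)"
          using A S_sets union(1)
          by (intro lebesgue_integral_countable_add int_set) (auto simp: disjoint_family_on_def)
        then show ?case using union(3) by (simp add: Int_UN_distrib[symmetric])
      qed
    qed
    \<comment> \<open>A density whose integral over every measurable set vanishes is zero almost
      everywhere; this upgrades vanishing of the measure on subsets of \<open>S\<close> to vanishing
      of its variation.\<close>
    have "AE z in M. indicator S z *\<^sub>R h z = 0"
    proof (rule density_zero)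
      show "integrable M (\<lambda>z. indicator S z *\<^sub>R h z)"
        using int_set[OF S_sets] by (simp add: set_integrable_def)
      show "(LINT z:A|M. indicator S z *\<^sub>R h z) = 0" if "A \<in> sets M" for A
        using zero[of A] that
        by (simp add: set_lebesgue_integral_def sets indicator_inter_arith mult.commute)
    qed
    then show ?thesis
      unfolding total_variation_def
      by (intro integral_eq_zero_AE) (auto simp: indicator_def split: if_splits elim!: eventually_mono)
  qed
  then show ?thesis by (auto simp: null_set_for_def)
qed

section \<open>The two algebras\<close>

text \<open>The product of the coordinates has no zero on \<open>S\<close>, so one interpolates the
  quotient of \<open>f\<close> by it and multiplies back.\<close>

lemma interpolation_polydisc_algebra0_iff:
  fixes S :: "(complex^'n::finite) set"
  assumes S: "S \<subseteq> torus"
  shows "interpolation_set polydisc_algebra S \<longleftrightarrow> interpolation_set polydisc_algebra0 S"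
proof
  assume "interpolation_set polydisc_algebra0 S"
  then show "interpolation_set polydisc_algebra S"
    using polydisc_algebra0_subset unfolding interpolation_set_def by blast
next
  assume interp: "interpolation_set polydisc_algebra S"
  show "interpolation_set polydisc_algebra0 S"
    unfolding interpolation_set_def
  proof (intro allI impI)
    fix f :: "complex^'n \<Rightarrow> complex" assume f: "continuous_on S f"
    have e0: "(\<Prod>i\<in>UNIV. z$i) \<noteq> 0" if "z \<in> S" for z :: "complex^'n"
      using norm_prod_torus[of z] S that by (metis norm_zero zero_neq_one subsetD)
    have "continuous_on S (\<lambda>z. f z / (\<Prod>i\<in>UNIV. z$i))"
      by (intro continuous_intros f ballI e0)
    then obtain g where g: "g \<in> polydisc_algebra" "\<And>z. z \<in> S \<Longrightarrow> g z = f z / (\<Prod>i\<in>UNIV. z$i)"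
      using interp unfolding interpolation_set_def by blast
    show "\<exists>g\<in>polydisc_algebra0. \<forall>z\<in>S. g z = f z"
    proof (rule bexI)
      show "(\<lambda>z. (\<Prod>i\<in>UNIV. z$i) * g z) \<in> polydisc_algebra0"
        using g(1) unfolding polydisc_algebra0_def by blast
      show "\<forall>z\<in>S. (\<Prod>i\<in>UNIV. z$i) * g z = f z" using g(2) e0 by simp
    qed
  qed
qed

text \<open>Multiplying the density by the coordinate product turns an annihilator of the smaller
  space into one of the full algebra, without changing the variation on \<open>S\<close>.\<close>

lemma null_set_polydisc_algebra0_iff:
  fixes S :: "(complex^'n::finite) set"
  assumes S: "S \<subseteq> torus"
  shows "null_set_for (annihilator polydisc_algebra0) S \<longleftrightarrow> null_set_for (annihilator polydisc_algebra) S"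
proof
  assume "null_set_for (annihilator polydisc_algebra0) S"
  moreover have "annihilator polydisc_algebra \<subseteq> (annihilator polydisc_algebra0 :: (_ \<times> (complex^'n \<Rightarrow> _)) set)"
    using polydisc_algebra0_subset by (auto simp: annihilator_def)
  ultimately show "null_set_for (annihilator polydisc_algebra) S"
    unfolding null_set_for_def by blast
next
  assume null: "null_set_for (annihilator polydisc_algebra) S"
  have "total_variation M h S = 0" if Mh: "(M, h) \<in> annihilator polydisc_algebra0" for M h
  proof -
    have rep: "cmeasure_rep M h"
      and ann: "\<And>g. g \<in> polydisc_algebra0 \<Longrightarrow> cm_integral M h g = 0"
      using Mh by (auto simp: annihilator_def)
    then have sets: "sets M = sets borel" and h: "integrable M h"
      by (auto simp: cmeasure_rep_def)
    define e where "e = (\<lambda>z::complex^'n. \<Prod>i\<in>UNIV. z$i)"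
    \<comment> \<open>The indicator keeps the multiplier bounded, since \<open>e\<close> is
      unbounded off the torus.\<close>
    define k where "k z = indicator torus z * e z * h z" for z
    have "integrable M k"
      unfolding k_def
    proof (rule integrable_bounded_mult[OF h])
      have "(\<lambda>z. indicator torus z * e z) \<in> borel_measurable borel"
        unfolding e_def by (intro borel_measurable_indicator_mult closed_torus continuous_intros)
      then show "(\<lambda>z. indicator torus z * e z) \<in> borel_measurable M"
        by (simp add: measurable_cong_sets[OF sets refl])
      show "cmod (indicator torus z * e z) \<le> 1" for z
        using norm_prod_torus[of z] by (cases "z \<in> torus") (auto simp: e_def)
    qed
    then have "cmeasure_rep M k" using rep by (simp add: cmeasure_rep_def)
    moreover have "cm_integral M k g = 0" if "g \<in> polydisc_algebra" for g
    proof -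
      have "cm_integral M k g = cm_integral M h (\<lambda>z. e z * g z)"
        unfolding cm_integral_def k_def
        by (intro Bochner_Integration.integral_cong refl) (simp add: indicator_def)
      also have "\<dots> = 0" using that by (intro ann) (auto simp: polydisc_algebra0_def e_def)
      finally show ?thesis .
    qed
    ultimately have "total_variation M k S = 0"
      using null by (auto simp: null_set_for_def annihilator_def)
    moreover have "total_variation M k S = total_variation M h S"
      unfolding total_variation_def
    proof (intro Bochner_Integration.integral_cong refl)
      fix z
      show "indicator S z * cmod (k z) = indicator S z * cmod (h z)"
        using S norm_prod_torus[of z] by (cases "z \<in> S") (auto simp: k_def e_def norm_mult)
    qed
    ultimately show ?thesis by simp
  qed
  then show "null_set_for (annihilator polydisc_algebra0) S" by (auto simp: null_set_for_def)
qed

theorem theorem1: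
  fixes S :: "(complex^'n::finite) set"
  assumes "compact S" and "S \<subseteq> torus"
  shows "(interpolation_set polydisc_algebra S \<longleftrightarrow> interpolation_set polydisc_algebra0 S)
       \<and> (null_set_for (annihilator polydisc_algebra0) S \<longleftrightarrow> null_set_for (annihilator polydisc_algebra) S)
       \<and> (interpolation_set polydisc_algebra0 S \<longleftrightarrow> null_set_for (annihilator polydisc_algebra0) S)"
  using interpolation_polydisc_algebra0_iff[OF assms(2)] null_set_polydisc_algebra0_iff[OF assms(2)]
    interpolation_of_null_set[OF assms] null_set_of_interpolation[OF assms]
  by blast

end
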